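(* Let $\Gamma$ be a countable discrete $C^*$-simple group, let $\mu\in\operatorname{Prob}(\Gamma)$ be a $C^*$-simple measure, and let $\mathcal{A}$ be a $\Gamma$-$C^*$-algebra. Then any $\mu$-stationary state $\tau$ on $\Gamma\ltimes_r\mathcal{A}$ is of the form $\tau=\nu\circ\sigma^{-1}\circ\mathbb{E}$ for some $\mu$-stationary state $\nu$ on $\mathcal{A}$.
   Context: A $\Gamma$-$C^*$-algebra is a unital $C^*$-algebra on which $\Gamma$ acts by $*$-automorphisms. $\operatorname{Prob}(\Gamma)$ is the set of probability measures on $\Gamma$. $\lambda:\Gamma\to\mathbb{B}(\ell^2(\Gamma))$ is the left regular representation, and $C^*_r(\Gamma)$ is the $C^*$-algebra generated by $\{\lambda_s:s\in\Gamma\}$. $\Gamma$ is $C^*$-simple if $C^*_r(\Gamma)$ is simple. $\tau_0$ is the canonical trace on $C^*_r(\Gamma)$, with $\tau_0(\lambda_e)=1$ and $\tau_0(\lambda_s)=0$ for $s\neq e$. $\Gamma$ acts on $C^*_r(\Gamma)$ by the inner automorphisms $a\mapsto\lambda_s a\lambda_s^*$. For a state $\tau$ on a $\Gamma$-$C^*$-algebra, $(s\tau)(a)=\tau(s^{-1}(a))$. For $\mu\in\operatorname{Prob}(\Gamma)$, $\mu*\tau=\sum_{s\in\Gamma}\mu(s)\,s\tau$, and $\tau$ is $\mu$-stationary if $\mu*\tau=\tau$. A measure $\mu\in\operatorname{Prob}(\Gamma)$ is a $C^*$-simple measure if $\tau_0$ is the unique $\mu$-stationary state on $C^*_r(\Gamma)$.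 Reduced crossed product: fix a faithful $*$-representation $\pi:\mathcal{A}\to\mathbb{B}(H)$ on a Hilbert space $H$. On $\ell^2(\Gamma,H)$ define $(\tilde\lambda_s\xi)(t)=\xi(s^{-1}t)$ and $[\sigma(a)\xi](t)=\pi(t^{-1}a)(\xi(t))$ for $s,t\in\Gamma$, $a\in\mathcal{A}$. Then $\Gamma\ltimes_r\mathcal{A}$ is the $C^*$-algebra generated by $\{\tilde\lambda_s\}_{s\in\Gamma}$ and $\sigma(\mathcal{A})$; $\sigma$ is injective, and $\sigma^{-1}$ denotes its inverse $\sigma(\mathcal{A})\to\mathcal{A}$. $\Gamma$ acts on $\Gamma\ltimes_r\mathcal{A}$ by the inner automorphisms $x\mapsto\tilde\lambda_s x\tilde\lambda_s^*$. $\mathbb{E}:\Gamma\ltimes_r\mathcal{A}\to\sigma(\mathcal{A})$ is the canonical conditional expectation, determined by $\mathbb{E}(\sigma(a))=\sigma(a)$ and $\mathbb{E}(\sigma(a)\tilde\lambda_s)=0$ for $a\in\mathcal{A}$, $s\in\Gamma\setminus\{e\}$. *)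

theory Defs
  imports "HOL-Analysis.Analysis" "HOL-Probability.Probability_Mass_Function"
begin

section \<open>Complex Hilbert spaces\<close>

class scaleC =
  fixes scaleC :: "complex \<Rightarrow> 'a \<Rightarrow> 'a" (infixr \<open>*\<^sub>C\<close> 75)

class complex_vector = real_vector + scaleC +
  assumes scaleC_add_right: "c *\<^sub>C (x + y) = c *\<^sub>C x + c *\<^sub>C y"
    and scaleC_add_left: "(c + d) *\<^sub>C x = c *\<^sub>C x + d *\<^sub>C x"
    and scaleC_scaleC [simp]: "c *\<^sub>C d *\<^sub>C x = (c * d) *\<^sub>C x"
    and scaleR_scaleC: "r *\<^sub>R x = complex_of_real r *\<^sub>C x"

class complex_normed_vector = complex_vector + real_normed_vector +
  assumes norm_scaleC [simp]: "norm (c *\<^sub>C x) = cmod c * norm x"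

class complex_inner = complex_normed_vector +
  fixes cinner :: "'a \<Rightarrow> 'a \<Rightarrow> complex"
  assumes cinner_commute: "cinner x y = cnj (cinner y x)"
    and cinner_add_left: "cinner (x + y) z = cinner x z + cinner y z"
    and cinner_scaleC_left: "cinner (c *\<^sub>C x) y = c * cinner x y"
    and cinner_self: "cinner x x = complex_of_real ((norm x)\<^sup>2)"

class chilbert_space = complex_inner + banach

lemma scaleC_one [simp]: "1 *\<^sub>C x = (x :: 'a::complex_vector)"
  by (metis of_real_1 scaleR_one scaleR_scaleC)

lemma scaleC_minus1 [simp]: "(-1) *\<^sub>C x = - (x :: 'a::complex_vector)"
  by (metis of_real_1 of_real_minus scaleR_minus1_left scaleR_scaleC)

lemma scaleC_zero_left [simp]: "0 *\<^sub>C x = (0 :: 'a::complex_vector)"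
  by (metis of_real_0 scaleR_zero_left scaleR_scaleC)

lemma scaleC_zero_right [simp]: "c *\<^sub>C 0 = (0 :: 'a::complex_vector)"
  by (metis add_cancel_right_right scaleC_add_right)

lemma scaleC_minus_right: "c *\<^sub>C (- x) = - (c *\<^sub>C (x :: 'a::complex_vector))"
  by (metis add.right_inverse eq_neg_iff_add_eq_0 scaleC_add_right scaleC_zero_right add.commute)

lemma scaleC_diff_right: "c *\<^sub>C (x - y) = c *\<^sub>C x - c *\<^sub>C (y :: 'a::complex_vector)"
  using scaleC_add_right[of c x "- y"] by (simp add: scaleC_minus_right)

lemma scaleC_scaleR_commute: "c *\<^sub>C (r *\<^sub>R x) = r *\<^sub>R (c *\<^sub>C (x :: 'a::complex_vector))"
  by (simp add: scaleR_scaleC mult.commute)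

lemma bounded_linear_scaleC: "bounded_linear (\<lambda>x :: 'a::complex_normed_vector. c *\<^sub>C x)"
  by (rule bounded_linear_intro[where K = "cmod c"])
    (auto simp: scaleC_add_right scaleC_scaleR_commute mult.commute)

lemma cinner_add_right: "cinner x (y + z) = cinner x y + cinner x (z :: 'a::complex_inner)"
  by (metis cinner_add_left cinner_commute complex_cnj_add)

lemma cinner_scaleC_right: "cinner x (c *\<^sub>C y) = cnj c * cinner x (y :: 'a::complex_inner)"
  by (metis cinner_commute cinner_scaleC_left complex_cnj_mult)

lemma cinner_zero_left [simp]: "cinner 0 (y :: 'a::complex_inner) = 0"
  by (metis cinner_add_left add_cancel_right_right)

lemma cinner_zero_right [simp]: "cinner (x :: 'a::complex_inner) 0 = 0"
  by (metis cinner_commute cinner_zero_left complex_cnj_zero)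

lemma cinner_minus_left: "cinner (- x) (y :: 'a::complex_inner) = - cinner x y"
  by (metis add.right_inverse cinner_add_left cinner_zero_left eq_neg_iff_add_eq_0 add.commute)

lemma cinner_minus_right: "cinner x (- y :: 'a::complex_inner) = - cinner x y"
  by (metis cinner_commute cinner_minus_left complex_cnj_minus)

lemma cinner_diff_left: "cinner (x - y) (z :: 'a::complex_inner) = cinner x z - cinner y z"
  using cinner_add_left[of x "- y" z] by (simp add: cinner_minus_left)

lemma cinner_diff_right: "cinner x (y - z :: 'a::complex_inner) = cinner x y - cinner x z"
  using cinner_add_right[of x y "- z"] by (simp add: cinner_minus_right)

lemma norm_add_squared:
  "(norm (x + y :: 'a::complex_inner))\<^sup>2 = (norm x)\<^sup>2 + 2 * Re (cinner x y) + (norm y)\<^sup>2"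
proof -
  have "complex_of_real ((norm (x + y))\<^sup>2)
      = cinner x x + cinner x y + cnj (cinner x y) + cinner y y"
    unfolding cinner_self[symmetric]
    by (simp add: cinner_add_left cinner_add_right cinner_commute[of y x])
  then have "Re (complex_of_real ((norm (x + y))\<^sup>2))
      = Re (cinner x x + cinner x y + cnj (cinner x y) + cinner y y)" by simp
  then show ?thesis by (simp add: cinner_self)
qed

lemma Re_cinner_le: "Re (cinner x y) \<le> norm x * norm (y :: 'a::complex_inner)"
proof -
  have "(norm (x + y))\<^sup>2 \<le> (norm x + norm y)\<^sup>2"
    by (simp add: norm_triangle_ineq power_mono)
  then show ?thesis by (simp add: norm_add_squared power2_sum)
qed

lemma norm_cinner_le: "cmod (cinner x y) \<le> norm x * norm (y :: 'a::complex_inner)"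
proof (cases "cinner x y = 0")
  case False
  define w where "w = cinner x y"
  define c where "c = cnj w / complex_of_real (cmod w)"
  have w: "w \<noteq> 0" using False by (simp add: w_def)
  then have c: "cmod c = 1" by (simp add: c_def norm_divide)
  have "c * w = (w * cnj w) / complex_of_real (cmod w)" by (simp add: c_def)
  also have "\<dots> = complex_of_real (cmod w)"
    using w by (simp add: complex_norm_square[symmetric] power2_eq_square)
  finally have "c * cinner x y = complex_of_real (cmod (cinner x y))" by (simp add: w_def)
  then have "Re (cinner (c *\<^sub>C x) y) = cmod (cinner x y)"
    by (simp add: cinner_scaleC_left)
  then show ?thesis using Re_cinner_le[of "c *\<^sub>C x" y] c by simp
qed auto

lemma parallelogram:
  "(norm (x + y))\<^sup>2 + (norm (x - y :: 'a::complex_inner))\<^sup>2 = 2 * (norm x)\<^sup>2 + 2 * (norm y)\<^sup>2"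
  using norm_add_squared[of x y] norm_add_squared[of x "- y"] by (simp add: cinner_minus_right)

instantiation complex :: chilbert_space
begin
definition scaleC_complex :: "complex \<Rightarrow> complex \<Rightarrow> complex" where "scaleC_complex c x = c * x"
definition cinner_complex :: "complex \<Rightarrow> complex \<Rightarrow> complex" where "cinner_complex x y = x * cnj y"
instance
  by standard (auto simp: scaleC_complex_def cinner_complex_def algebra_simps scaleR_conv_of_real
      norm_mult complex_norm_square[symmetric])
end


section \<open>Unital \<open>C\<^sup>*\<close>-algebras\<close>

class star =
  fixes star :: "'a \<Rightarrow> 'a"

text \<open>The base class is \<^class>\<open>monoid_mult\<close> with \<^class>\<open>real_normed_algebra\<close> rather than
  \<^class>\<open>real_normed_algebra_1\<close>, so that the zero algebra (such as the operators on the zero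
  Hilbert space) is not excluded.\<close>

class cstar_algebra = complex_normed_vector + real_normed_algebra + monoid_mult + banach + star +
  assumes mult_scaleC_left: "(c *\<^sub>C x) * y = c *\<^sub>C (x * y)"
    and mult_scaleC_right: "x * (c *\<^sub>C y) = c *\<^sub>C (x * y)"
    and star_star [simp]: "star (star x) = x"
    and star_add: "star (x + y) = star x + star y"
    and star_scaleC: "star (c *\<^sub>C x) = cnj c *\<^sub>C star x"
    and star_mult: "star (x * y) = star y * star x"
    and cstar_identity: "norm (star x * x) = (norm x)\<^sup>2"

definition star_hom :: "('a::cstar_algebra \<Rightarrow> 'b::cstar_algebra) \<Rightarrow> bool" where
  "star_hom f \<longleftrightarrow>
     (\<forall>x y. f (x + y) = f x + f y) \<and> (\<forall>c x. f (c *\<^sub>C x) = c *\<^sub>C f x) \<and>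
     (\<forall>x y. f (x * y) = f x * f y) \<and> (\<forall>x. f (star x) = star (f x)) \<and> f 1 = 1"

definition cstar_subalgebra :: "'a::cstar_algebra set \<Rightarrow> bool" where
  "cstar_subalgebra B \<longleftrightarrow> closed B \<and> 0 \<in> B \<and>
     (\<forall>x\<in>B. \<forall>y\<in>B. x + y \<in> B) \<and> (\<forall>c. \<forall>x\<in>B. c *\<^sub>C x \<in> B) \<and>
     (\<forall>x\<in>B. \<forall>y\<in>B. x * y \<in> B) \<and> (\<forall>x\<in>B. star x \<in> B)"

definition cstar_generated :: "'a::cstar_algebra set \<Rightarrow> 'a set" where
  "cstar_generated S = cstar_subalgebra hull S"

definition closed_ideal :: "'a::cstar_algebra set \<Rightarrow> 'a set \<Rightarrow> bool" where
  "closed_ideal B I \<longleftrightarrow> I \<subseteq> B \<and> closed I \<and> 0 \<in> I \<and>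
     (\<forall>x\<in>I. \<forall>y\<in>I. x + y \<in> I) \<and> (\<forall>c. \<forall>x\<in>I. c *\<^sub>C x \<in> I) \<and>
     (\<forall>b\<in>B. \<forall>x\<in>I. b * x \<in> I \<and> x * b \<in> I)"

definition simple_cstar :: "'a::cstar_algebra set \<Rightarrow> bool" where
  "simple_cstar B \<longleftrightarrow> B \<noteq> {0} \<and> (\<forall>I. closed_ideal B I \<longrightarrow> I = {0} \<or> I = B)"

text \<open>Functionals on a subalgebra \<open>B\<close> are functions on the ambient type of which only the values
  on \<open>B\<close> matter.\<close>

definition state_on :: "'a::cstar_algebra set \<Rightarrow> ('a \<Rightarrow> complex) \<Rightarrow> bool" where
  "state_on B \<phi> \<longleftrightarrow>
     (\<forall>x\<in>B. \<forall>y\<in>B. \<phi> (x + y) = \<phi> x + \<phi> y) \<and> (\<forall>c. \<forall>x\<in>B. \<phi> (c *\<^sub>C x) = c * \<phi> x) \<and>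
     (\<forall>x\<in>B. \<phi> (star x * x) \<in> \<real>\<^sub>\<ge>\<^sub>0) \<and> \<phi> 1 = 1"

definition conditional_expectation ::
  "'a::cstar_algebra set \<Rightarrow> 'a set \<Rightarrow> ('a \<Rightarrow> 'a) \<Rightarrow> bool" where
  "conditional_expectation B C E \<longleftrightarrow>
     (\<forall>x\<in>B. E x \<in> C) \<and> (\<forall>y\<in>C. E y = y) \<and>
     (\<forall>x\<in>B. \<forall>y\<in>B. E (x + y) = E x + E y) \<and> (\<forall>c. \<forall>x\<in>B. E (c *\<^sub>C x) = c *\<^sub>C E x) \<and>
     (\<forall>x\<in>B. norm (E x) \<le> norm x) \<and>
     (\<forall>x\<in>B. \<exists>y\<in>C. E (star x * x) = star y * y) \<and>
     (\<forall>y\<in>C. \<forall>x\<in>B. \<forall>z\<in>C. E (y * x * z) = y * E x * z)"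


section \<open>The \<open>C\<^sup>*\<close>-algebra of bounded operators on a Hilbert space\<close>

lemma riesz:
  fixes f :: "'h::chilbert_space \<Rightarrow> complex"
  assumes f: "bounded_linear f" and fC: "\<And>c x. f (c *\<^sub>C x) = c * f x"
  shows "\<exists>z. \<forall>x. f x = cinner x z"
proof -
  interpret bounded_linear f by fact
  obtain M where M: "\<And>x. cmod (f x) \<le> norm x * M" using bounded by blast
  define J where "J x = (norm x)\<^sup>2 - 2 * Re (f x)" for x
  have J_ge: "- M\<^sup>2 \<le> J x" for x
  proof -
    have "Re (f x) \<le> norm x * M" using complex_Re_le_cmod[of "f x"] M[of x] by linarith
    moreover have "0 \<le> (norm x - M)\<^sup>2" by simp
    ultimately show ?thesis by (simp add: J_def power2_diff)
  qed
  define d where "d = (INF x. J x)"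
  have bdd: "bdd_below (range J)" using J_ge by (auto intro!: bdd_belowI)
  have d_le: "d \<le> J x" for x unfolding d_def using bdd by (rule cINF_lower) simp
  have "\<exists>x. J x < d + 1 / real (Suc n)" for n
    using cInf_lessD[of "range J" "d + 1 / real (Suc n)"] by (auto simp: d_def)
  then obtain X where X: "\<And>n. J (X n) < d + 1 / real (Suc n)" by metis
  have para: "(norm (x - y))\<^sup>2 \<le> 2 * (J x - d) + 2 * (J y - d)" for x y
  proof -
    have "(norm ((1/2) *\<^sub>R (x + y)))\<^sup>2 = (norm (x + y))\<^sup>2 / 4"
      by (simp add: power_divide del: scaleR_add_right)
    moreover have "Re (f ((1/2) *\<^sub>R (x + y))) = Re (f x + f y) / 2"
      by (simp add: scaleR add del: scaleR_add_right)
    ultimately have "4 * J ((1/2) *\<^sub>R (x + y)) = (norm (x + y))\<^sup>2 - 4 * Re (f x + f y)"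
      unfolding J_def by simp
    moreover have "4 * d \<le> 4 * J ((1/2) *\<^sub>R (x + y))" using d_le by simp
    ultimately show ?thesis using parallelogram[of x y] by (simp add: J_def)
  qed
  have "Cauchy X"
  proof (rule metric_CauchyI)
    fix e :: real assume e: "e > 0"
    obtain N where N: "1 / real (Suc N) < e\<^sup>2 / 4"
      using reals_Archimedean[of "e\<^sup>2 / 4"] e by (auto simp: inverse_eq_divide)
    have *: "J (X m) - d < e\<^sup>2 / 4" if "m \<ge> N" for m
    proof -
      have "1 / real (Suc m) \<le> 1 / real (Suc N)" using that by (intro divide_left_mono) auto
      then show ?thesis using X[of m] N by linarith
    qed
    have "dist (X m) (X n) < e" if "m \<ge> N" "n \<ge> N" for m n
    proof -
      have "(norm (X m - X n))\<^sup>2 < e\<^sup>2" using para[of "X m" "X n"] *[OF that(1)] *[OF that(2)] by argo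
      then show ?thesis using e by (simp add: dist_norm power_less_imp_less_base)
    qed
    then show "\<exists>N. \<forall>m\<ge>N. \<forall>n\<ge>N. dist (X m) (X n) < e" by blast
  qed
  then obtain z where z: "X \<longlonglongrightarrow> z" using Cauchy_convergent_iff convergent_def by blast
  have "(\<lambda>n. J (X n)) \<longlonglongrightarrow> J z" unfolding J_def by (intro tendsto_intros z tendsto)
  moreover have "(\<lambda>n. d + 1 / real (Suc n)) \<longlonglongrightarrow> d"
    using tendsto_add[OF tendsto_const[of d] lim_inverse_n'[THEN LIMSEQ_Suc]] by simp
  ultimately have Jz: "J z \<le> d"
    using X by (intro LIMSEQ_le) (auto intro: less_imp_le)
  have Re_eq: "Re (f x) = Re (cinner x z)" for x
  proof (rule ccontr)
    assume neq: "Re (f x) \<noteq> Re (cinner x z)"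
    define b where "b = Re (cinner z x) - Re (f x)"
    have bne: "b \<noteq> 0" using neq cinner_commute[of z x] by (simp add: b_def)
    have "cinner z (t *\<^sub>R x) = complex_of_real t * cinner z x" for t
      by (simp only: scaleR_scaleC cinner_scaleC_right complex_cnj_complex_of_real)
    then have J: "J (z + t *\<^sub>R x) = J z + 2 * t * b + t\<^sup>2 * (norm x)\<^sup>2" for t
      by (simp add: J_def norm_add_squared add scaleR b_def power_mult_distrib algebra_simps)
    have ge: "0 \<le> 2 * t * b + t\<^sup>2 * (norm x)\<^sup>2" for t
      using J[of t] Jz d_le[of "z + t *\<^sub>R x"] by linarith
    define s where "s = (norm x)\<^sup>2 + 1"
    have s: "s > 0" by (simp add: s_def add_nonneg_pos)
    have "2 * (- b / s) * b + (- b / s)\<^sup>2 * (norm x)\<^sup>2 = (b\<^sup>2 / s\<^sup>2) * ((norm x)\<^sup>2 - 2 * s)"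
      using s by (simp add: field_simps power2_eq_square)
    also have "\<dots> < 0" using s bne by (intro mult_pos_neg) (auto simp: s_def)
    finally show False using ge[of "- b / s"] by simp
  qed
  have "f x = cinner x z" for x
  proof (rule complex_eqI)
    show "Re (f x) = Re (cinner x z)" by (rule Re_eq)
    show "Im (f x) = Im (cinner x z)"
      using Re_eq[of "\<i> *\<^sub>C x"] by (simp add: fC cinner_scaleC_left)
  qed
  then show ?thesis by blast
qed

typedef (overloaded) 'h bop =
  "{T :: 'h::complex_normed_vector \<Rightarrow> 'h. bounded_linear T \<and> (\<forall>c x. T (c *\<^sub>C x) = c *\<^sub>C T x)}"
  morphisms bop_apply Bop
  by (rule exI[of _ "\<lambda>x. 0"]) auto

declare [[coercion "bop_apply :: 'h::complex_normed_vector bop \<Rightarrow> 'h \<Rightarrow> 'h"]]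

setup_lifting type_definition_bop

lemma bop_eqI: "(\<And>x. bop_apply S x = bop_apply T x) \<Longrightarrow> S = T"
  by transfer auto

lemma bounded_linear_bop: "bounded_linear (bop_apply T)"
  using bop_apply by auto

lemma bop_scaleC: "bop_apply T (c *\<^sub>C x) = c *\<^sub>C bop_apply T x"
  using bop_apply by auto

instantiation bop :: (complex_normed_vector) complex_normed_vector
begin

lift_definition norm_bop :: "'a bop \<Rightarrow> real" is onorm .

lift_definition minus_bop :: "'a bop \<Rightarrow> 'a bop \<Rightarrow> 'a bop" is "\<lambda>f g x. f x - g x"
  by (simp add: bounded_linear_sub scaleC_diff_right)

lift_definition uminus_bop :: "'a bop \<Rightarrow> 'a bop" is "\<lambda>f x. - f x"
  by (simp add: bounded_linear_minus scaleC_minus_right)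

lift_definition zero_bop :: "'a bop" is "\<lambda>x. 0"
  by simp

lift_definition plus_bop :: "'a bop \<Rightarrow> 'a bop \<Rightarrow> 'a bop" is "\<lambda>f g x. f x + g x"
  by (simp add: bounded_linear_add scaleC_add_right)

lift_definition scaleC_bop :: "complex \<Rightarrow> 'a bop \<Rightarrow> 'a bop" is "\<lambda>c f x. c *\<^sub>C f x"
  by (auto simp: mult.commute intro: bounded_linear_compose[OF bounded_linear_scaleC])

definition scaleR_bop :: "real \<Rightarrow> 'a bop \<Rightarrow> 'a bop" where
  "scaleR_bop r T = complex_of_real r *\<^sub>C T"

definition dist_bop :: "'a bop \<Rightarrow> 'a bop \<Rightarrow> real" where
  "dist_bop S T = norm (S - T)"

definition
  "(uniformity :: ('a bop \<times> 'a bop) filter) = (INF e\<in>{0 <..}. principal {(x, y). dist x y < e})"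

definition open_bop :: "'a bop set \<Rightarrow> bool" where
  "open_bop S = (\<forall>x\<in>S. \<forall>\<^sub>F (x', y) in uniformity. x' = x \<longrightarrow> y \<in> S)"

definition sgn_bop :: "'a bop \<Rightarrow> 'a bop" where
  "sgn_bop T = inverse (norm T) *\<^sub>R T"

lemma onorm_scaleC:
  assumes "bounded_linear (f :: 'a \<Rightarrow> 'a)"
  shows "onorm (\<lambda>x. c *\<^sub>C f x) = cmod c * onorm f"
proof -
  have "norm (c *\<^sub>C f x) / norm x = norm (cmod c *\<^sub>R f x) / norm x" for x by simp
  then have "onorm (\<lambda>x. c *\<^sub>C f x) = onorm (\<lambda>x. cmod c *\<^sub>R f x)"
    unfolding onorm_def by presburger
  then show ?thesis using onorm_scaleR[OF assms, of "cmod c"] by simp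
qed

instance
proof
  fix S T U :: "'a bop" and c d :: complex and r r' :: real
  show "dist S T = norm (S - T)" by (rule dist_bop_def)
  show "(uniformity :: ('a bop \<times> 'a bop) filter) = (INF e\<in>{0 <..}. principal {(x, y). dist x y < e})"
    by (rule uniformity_bop_def)
  show "open A = (\<forall>x\<in>A. \<forall>\<^sub>F (x', y) in uniformity. x' = x \<longrightarrow> y \<in> A)" for A :: "'a bop set"
    by (rule open_bop_def)
  show "sgn T = inverse (norm T) *\<^sub>R T" by (rule sgn_bop_def)
  show "S + T + U = S + (T + U)" by transfer (simp add: algebra_simps)
  show "S + T = T + S" by transfer (simp add: algebra_simps)
  show "0 + T = T" by transfer simp
  show "- T + T = 0" by transfer simp
  show "S - T = S + - T" by transfer simp
  show "c *\<^sub>C (S + T) = c *\<^sub>C S + c *\<^sub>C T" by transfer (simp add: scaleC_add_right)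
  show "(c + d) *\<^sub>C T = c *\<^sub>C T + d *\<^sub>C T" by transfer (simp add: scaleC_add_left)
  show "c *\<^sub>C d *\<^sub>C T = (c * d) *\<^sub>C T" by transfer simp
  show "r *\<^sub>R T = complex_of_real r *\<^sub>C T" by (rule scaleR_bop_def)
  show "r *\<^sub>R (S + T) = r *\<^sub>R S + r *\<^sub>R T"
    unfolding scaleR_bop_def by transfer (simp add: scaleC_add_right)
  show "(r + r') *\<^sub>R T = r *\<^sub>R T + r' *\<^sub>R T"
    unfolding scaleR_bop_def by transfer (simp add: scaleC_add_left)
  show "r *\<^sub>R r' *\<^sub>R T = (r * r') *\<^sub>R T"
    unfolding scaleR_bop_def by transfer simp
  show "1 *\<^sub>R T = T"
    unfolding scaleR_bop_def by transfer simp
  show "(norm T = 0) = (T = 0)" by transfer (auto simp: onorm_eq_0)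
  show "norm (S + T) \<le> norm S + norm T" by transfer (simp add: onorm_triangle)
  show nC: "norm (c *\<^sub>C T) = cmod c * norm T" for c by transfer (simp add: onorm_scaleC)
  show "norm (r *\<^sub>R T) = \<bar>r\<bar> * norm T"
    unfolding scaleR_bop_def by (simp add: nC)
qed

end

lemma minus_bop_apply: "bop_apply (S - T) x = bop_apply S x - bop_apply T x"
  by transfer simp

lemma norm_bop: "norm (bop_apply T x) \<le> norm T * norm x"
  by transfer (simp add: onorm)

lemma norm_bop_bound: "0 \<le> b \<Longrightarrow> (\<And>x. norm (bop_apply T x) \<le> b * norm x) \<Longrightarrow> norm T \<le> b"
  by transfer (simp add: onorm_bound)

text \<open>The adjoint is characterised by \<open>cinner_bop_right\<close> below; it exists by the Riesz
  representation theorem.\<close>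

instantiation bop :: (chilbert_space) cstar_algebra
begin

lift_definition times_bop :: "'a bop \<Rightarrow> 'a bop \<Rightarrow> 'a bop" is "\<lambda>f g x. f (g x)"
  by (auto intro: bounded_linear_compose)

lift_definition one_bop :: "'a bop" is "\<lambda>x. x"
  by simp

definition star_bop :: "'a bop \<Rightarrow> 'a bop" where
  "star_bop T = (THE S :: 'a bop. \<forall>x y. cinner (T x) y = cinner x (S y))"

lemma adjoint_ex: "\<exists>S :: 'a bop. \<forall>x y. cinner (bop_apply T x) y = cinner x (bop_apply S y)"
proof -
  interpret T: bounded_linear "bop_apply T" by (rule bounded_linear_bop)
  have "\<exists>z. \<forall>x. cinner (T x) y = cinner x z" for y
  proof (rule riesz)
    show "bounded_linear (\<lambda>x. cinner (T x) y)"
    proof (rule bounded_linear_intro[where K = "norm T * norm y"])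
      show "norm (cinner (T x) y) \<le> norm x * (norm T * norm y)" for x
        using norm_cinner_le[of "T x" y] mult_right_mono[OF norm_bop[of T x], of "norm y"]
        by (simp add: mult_ac)
    qed (auto simp: T.add T.scaleR cinner_add_left scaleR_scaleC scaleC_complex_def
        cinner_scaleC_left bop_scaleC)
  qed (simp add: bop_scaleC cinner_scaleC_left)
  then obtain s where s: "\<And>x y. cinner (T x) y = cinner x (s y)" by metis
  have ext: "u = v" if "\<And>x. cinner x u = cinner x v" for u v :: 'a
  proof -
    have "cinner (u - v) (u - v) = 0" using that[of "u - v"] by (simp add: cinner_diff_right)
    then show ?thesis by (simp add: cinner_self)
  qed
  have s_add: "s (x + y) = s x + s y" for x y
    by (rule ext) (simp add: cinner_add_right flip: s)
  have s_scaleC: "s (c *\<^sub>C x) = c *\<^sub>C s x" for c x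
    by (rule ext) (simp add: cinner_scaleC_right flip: s)
  have "norm (s y) \<le> norm y * norm T" for y
  proof (cases "norm (s y) = 0")
    case False
    have "(norm (s y))\<^sup>2 = Re (cinner (T (s y)) y)" by (simp add: s cinner_self)
    also have "\<dots> \<le> norm (T (s y)) * norm y" by (rule Re_cinner_le)
    also have "\<dots> \<le> norm T * norm (s y) * norm y" by (intro mult_right_mono norm_bop) simp
    finally have "norm (s y) * norm (s y) \<le> norm (s y) * (norm y * norm T)"
      by (simp add: power2_eq_square mult_ac)
    then show ?thesis using False by (simp add: mult_le_cancel_left)
  qed auto
  then have "bounded_linear s"
    by (intro bounded_linear_intro[where K = "norm T"]) (auto simp: s_add scaleR_scaleC s_scaleC)
  then have "bop_apply (Bop s) = s" by (simp add: Bop_inverse s_scaleC)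
  then show ?thesis using s by metis
qed

lemma adjoint_unique:
  fixes S S' :: "'a bop"
  assumes "\<And>x y. cinner x (bop_apply S y) = cinner x (bop_apply S' y)"
  shows "S = S'"
proof (rule bop_eqI)
  fix y
  have "cinner (S y - S' y) (S y - S' y) = 0" using assms[of "S y - S' y" y] by (simp add: cinner_diff_right)
  then show "S y = S' y" by (simp add: cinner_self)
qed

lemma cinner_bop_left: "cinner (bop_apply T x) y = cinner x (bop_apply (star T) (y :: 'a))"
proof -
  have "\<exists>!S :: 'a bop. \<forall>x y. cinner (T x) y = cinner x (S y)"
    using adjoint_ex[of T] by (auto intro!: adjoint_unique)
  from theI'[OF this] show ?thesis unfolding star_bop_def by blast
qed

lemma cinner_bop_right: "cinner x (bop_apply T (y :: 'a)) = cinner (bop_apply (star T) x) y"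
  by (metis cinner_bop_left cinner_commute)

instance
proof
  fix S T U :: "'a bop" and c :: complex and r :: real
  show "S * T * U = S * (T * U)" by transfer simp
  show "1 * T = T" by transfer simp
  show "T * 1 = T" by transfer simp
  show "(S + T) * U = S * U + T * U" by transfer simp
  show "S * (T + U) = S * T + S * U"
    by transfer (simp add: linear_add bounded_linear.linear)
  show L: "(c *\<^sub>C S) * T = c *\<^sub>C (S * T)" for c by transfer simp
  show R: "S * (c *\<^sub>C T) = c *\<^sub>C (S * T)" for c by transfer simp
  show "(r *\<^sub>R S) * T = r *\<^sub>R (S * T)" unfolding scaleR_bop_def by (rule L)
  show "S * (r *\<^sub>R T) = r *\<^sub>R (S * T)" unfolding scaleR_bop_def by (rule R)
  have mult: "(S * T) x = S (T x)" for S T :: "'a bop" and x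
    by (simp add: times_bop.rep_eq)
  have plus: "(S + T) x = S x + T x" for S T :: "'a bop" and x
    by (simp add: plus_bop.rep_eq)
  have scale: "(c *\<^sub>C T) x = c *\<^sub>C T x" for T :: "'a bop" and c x
    by (simp add: scaleC_bop.rep_eq)
  show "star (star T) = T"
    by (rule adjoint_unique) (metis cinner_bop_left cinner_bop_right)
  show "star (S + T) = star S + star T"
    by (rule adjoint_unique) (simp add: plus cinner_add_left cinner_add_right flip: cinner_bop_left)
  show "star (c *\<^sub>C T) = cnj c *\<^sub>C star T"
    by (rule adjoint_unique) (simp add: scale cinner_scaleC_left cinner_scaleC_right flip: cinner_bop_left)
  show "star (S * T) = star T * star S"
    by (rule adjoint_unique) (simp add: mult flip: cinner_bop_left)
  show norm_mult: "norm (S * T) \<le> norm S * norm T" for S T :: "'a bop"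
  proof (rule norm_bop_bound)
    show "norm ((S * T) x) \<le> norm S * norm T * norm x" for x
      using norm_bop[of S "T x"] mult_left_mono[OF norm_bop[of T x], of "norm S"]
      by (simp add: mult mult_ac)
  qed simp
  have sq: "(norm T)\<^sup>2 \<le> norm (star T * T)" for T :: "'a bop"
  proof -
    have "(norm (T x))\<^sup>2 \<le> norm (star T * T) * (norm x)\<^sup>2" for x
    proof -
      have "(norm (T x))\<^sup>2 = Re (cinner x ((star T * T) x))"
        by (simp add: mult cinner_self flip: cinner_bop_left)
      also have "\<dots> \<le> norm x * norm ((star T * T) x)" by (rule Re_cinner_le)
      also have "\<dots> \<le> norm x * (norm (star T * T) * norm x)" by (intro mult_left_mono norm_bop) simp
      finally show ?thesis by (simp add: power2_eq_square mult_ac)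
    qed
    then have le: "norm (T x) \<le> sqrt (norm (star T * T)) * norm x" for x
      using real_sqrt_le_mono by (fastforce simp: real_sqrt_mult)
    have "norm T \<le> sqrt (norm (star T * T))" by (rule norm_bop_bound[OF _ le]) simp
    then have "(norm T)\<^sup>2 \<le> (sqrt (norm (star T * T)))\<^sup>2" by (rule power_mono) simp
    then show ?thesis by simp
  qed
  have star_le: "norm T \<le> norm (star T)" for T :: "'a bop"
  proof (cases "norm T = 0")
    case False
    have "norm T * norm T \<le> norm (star T) * norm T"
      using sq[of T] norm_mult[of "star T" T] by (simp add: power2_eq_square)
    then show ?thesis using False by (simp add: mult_le_cancel_right)
  qed auto
  have "norm (star T) = norm T"
    using star_le[of T] star_le[of "star T"] \<open>star (star T) = T\<close> by simp
  then show "norm (star T * T) = (norm T)\<^sup>2"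
    using sq[of T] norm_mult[of "star T" T] by (simp add: power2_eq_square)
next
  fix X :: "nat \<Rightarrow> 'a bop"
  assume X: "Cauchy X"
  have Bl: "blinfun_apply (Blinfun (bop_apply T)) = bop_apply T" for T :: "'a bop"
    by (simp add: bounded_linear_Blinfun_apply bounded_linear_bop)
  have dist: "dist (Blinfun (bop_apply S)) (Blinfun (bop_apply T)) = dist S T" for S T :: "'a bop"
  proof -
    have "Blinfun (bop_apply S) - Blinfun (bop_apply T) = Blinfun (bop_apply (S - T))"
      by (rule blinfun_eqI) (simp only: Bl blinfun.diff_left minus_bop_apply)
    then show ?thesis unfolding dist_norm by (simp only: norm_blinfun.rep_eq norm_bop.rep_eq Bl)
  qed
  have "Cauchy (\<lambda>n. Blinfun (bop_apply (X n)))"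
    using X unfolding Cauchy_def dist .
  then obtain L where L: "(\<lambda>n. Blinfun (bop_apply (X n))) \<longlonglongrightarrow> L"
    using Cauchy_convergent_iff convergent_def by blast
  have Lx: "(\<lambda>n. X n x) \<longlonglongrightarrow> L x" for x
    using blinfun.tendsto[OF L tendsto_const[of x]] by (simp add: Bl)
  have "L (c *\<^sub>C x) = c *\<^sub>C L x" for c x
  proof (rule LIMSEQ_unique[OF Lx])
    show "(\<lambda>n. X n (c *\<^sub>C x)) \<longlonglongrightarrow> c *\<^sub>C L x"
      unfolding bop_scaleC by (rule bounded_linear.tendsto[OF bounded_linear_scaleC Lx])
  qed
  then have "bop_apply (Bop (blinfun_apply L)) = blinfun_apply L"
    by (simp add: Bop_inverse blinfun.bounded_linear_right)
  then have "Blinfun (bop_apply (Bop (blinfun_apply L))) = L" by (simp add: blinfun_apply_inverse)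
  then have "(\<lambda>n. Blinfun (bop_apply (X n))) \<longlonglongrightarrow> Blinfun (bop_apply (Bop (blinfun_apply L)))"
    using L by simp
  then have "X \<longlonglongrightarrow> Bop (blinfun_apply L)"
    unfolding lim_sequentially dist by blast
  then show "convergent X" by (rule convergentI)
qed

end


section \<open>The Hilbert space \<open>\<ell>\<^sup>2(\<Gamma>, H)\<close>\<close>

definition square_summable :: "('g \<Rightarrow> 'h::real_normed_vector) \<Rightarrow> bool" where
  "square_summable f \<longleftrightarrow> (\<lambda>t. (norm (f t))\<^sup>2) summable_on UNIV"

definition l2norm :: "('g \<Rightarrow> 'h::real_normed_vector) \<Rightarrow> real" where
  "l2norm f = sqrt (\<Sum>\<^sub>\<infinity>t. (norm (f t))\<^sup>2)"

lemma l2norm_nonneg [simp]: "0 \<le> l2norm f"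
  by (simp add: l2norm_def infsum_nonneg)

lemma L2_set_le_l2norm:
  assumes "square_summable f" "finite F"
  shows "L2_set (\<lambda>t. norm (f t)) F \<le> l2norm f"
  using assms unfolding L2_set_def l2norm_def square_summable_def
  by (intro real_sqrt_le_mono finite_sum_le_infsum) auto

lemma norm_le_l2norm: "square_summable f \<Longrightarrow> norm (f t) \<le> l2norm f"
  using L2_set_le_l2norm[of f "{t}"] by (simp add: L2_set_def)

lemma square_summable_bound:
  assumes "\<And>F. finite F \<Longrightarrow> L2_set (\<lambda>t. norm (f t)) F \<le> b"
  shows "square_summable f" and "l2norm f \<le> b"
proof -
  have b: "0 \<le> b" using assms[of "{}"] by simp
  have le: "(\<Sum>t\<in>F. (norm (f t))\<^sup>2) \<le> b\<^sup>2" if "finite F" for F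
    using power_mono[OF assms[OF that], of 2] by (simp add: L2_set_def sum_nonneg)
  show "square_summable f" unfolding square_summable_def
    by (rule nonneg_bdd_above_summable_on) (auto intro!: bdd_aboveI2[of _ _ "b\<^sup>2"] le)
  then have "(\<Sum>\<^sub>\<infinity>t. (norm (f t))\<^sup>2) \<le> b\<^sup>2"
    unfolding square_summable_def by (rule infsum_le_finite_sums) (rule le)
  then show "l2norm f \<le> b" using b unfolding l2norm_def by (simp add: real_le_lsqrt)
qed

lemma l2_add:
  assumes "square_summable f" "square_summable g"
  shows square_summable_add: "square_summable (\<lambda>t. f t + g t)"
    and l2norm_triangle: "l2norm (\<lambda>t. f t + g t) \<le> l2norm f + l2norm g"
proof -
  have "L2_set (\<lambda>t. norm (f t + g t)) F \<le> l2norm f + l2norm g" if "finite F" for F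
  proof -
    have "L2_set (\<lambda>t. norm (f t + g t)) F \<le> L2_set (\<lambda>t. norm (f t) + norm (g t)) F"
      by (intro L2_set_mono norm_triangle_ineq) simp
    also have "\<dots> \<le> L2_set (\<lambda>t. norm (f t)) F + L2_set (\<lambda>t. norm (g t)) F"
      by (rule L2_set_triangle_ineq)
    also have "\<dots> \<le> l2norm f + l2norm g"
      using assms that by (intro add_mono L2_set_le_l2norm)
    finally show ?thesis .
  qed
  from square_summable_bound[OF this]
  show "square_summable (\<lambda>t. f t + g t)" "l2norm (\<lambda>t. f t + g t) \<le> l2norm f + l2norm g" by auto
qed

lemma square_summable_scaleC:
  "square_summable f \<Longrightarrow> square_summable (\<lambda>t. c *\<^sub>C (f t :: 'h::complex_normed_vector))"
  unfolding square_summable_def by (simp add: power_mult_distrib summable_on_cmult_right)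

lemma l2norm_scaleC: "l2norm (\<lambda>t. c *\<^sub>C (f t :: 'h::complex_normed_vector)) = cmod c * l2norm f"
  unfolding l2norm_def by (simp add: power_mult_distrib infsum_cmult_right' real_sqrt_mult)

lemma square_summable_uminus: "square_summable f \<Longrightarrow> square_summable (\<lambda>t. - f t)"
  unfolding square_summable_def by simp

lemma square_summable_diff:
  "square_summable f \<Longrightarrow> square_summable g \<Longrightarrow> square_summable (\<lambda>t. f t - g t)"
  using square_summable_add[of f "\<lambda>t. - g t"] square_summable_uminus[of g] by simp

lemma summable_cinner:
  fixes f g :: "'g \<Rightarrow> 'h::complex_inner"
  assumes "square_summable f" "square_summable g"
  shows "(\<lambda>t. cinner (f t) (g t)) summable_on UNIV"
proof (rule abs_summable_summable, rule Infinite_Sum.abs_summable_on_comparison_test)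
  have "(\<lambda>t. (norm (f t))\<^sup>2 + (norm (g t))\<^sup>2) summable_on UNIV"
    using assms unfolding square_summable_def by (rule summable_on_add)
  moreover have "norm ((norm (f t))\<^sup>2 + (norm (g t))\<^sup>2) = (norm (f t))\<^sup>2 + (norm (g t))\<^sup>2" for t
    unfolding real_norm_def by (rule abs_of_nonneg) simp
  ultimately show "(\<lambda>t. norm ((norm (f t))\<^sup>2 + (norm (g t))\<^sup>2)) summable_on UNIV"
    by presburger
  fix t
  have "0 \<le> (norm (f t) - norm (g t))\<^sup>2" by simp
  then have "2 * (norm (f t) * norm (g t)) \<le> (norm (f t))\<^sup>2 + (norm (g t))\<^sup>2"
    by (simp add: power2_diff)
  moreover have "0 \<le> norm (f t) * norm (g t)" by simp
  ultimately show "norm (cinner (f t) (g t)) \<le> norm ((norm (f t))\<^sup>2 + (norm (g t))\<^sup>2)"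
    using norm_cinner_le[of "f t" "g t"] abs_ge_self[of "(norm (f t))\<^sup>2 + (norm (g t))\<^sup>2"]
    unfolding real_norm_def by linarith
qed

typedef (overloaded) ('g, 'h) ell2 = "{\<xi> :: 'g \<Rightarrow> 'h::complex_inner. square_summable \<xi>}"
  morphisms ell2_apply Ell2
  by (rule exI[of _ "\<lambda>t. 0"]) (simp add: square_summable_def)

declare [[coercion "ell2_apply :: ('g, 'h::complex_inner) ell2 \<Rightarrow> 'g \<Rightarrow> 'h"]]

setup_lifting type_definition_ell2

lemma ell2_eqI: "(\<And>t. ell2_apply \<xi> t = ell2_apply \<eta> t) \<Longrightarrow> \<xi> = \<eta>"
  by transfer auto

lemma square_summable_ell2: "square_summable (ell2_apply \<xi>)"
  using ell2_apply by auto

instantiation ell2 :: (type, complex_inner) complex_inner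
begin

lift_definition norm_ell2 :: "('a, 'b) ell2 \<Rightarrow> real" is l2norm .

lift_definition cinner_ell2 :: "('a, 'b) ell2 \<Rightarrow> ('a, 'b) ell2 \<Rightarrow> complex"
  is "\<lambda>f g. \<Sum>\<^sub>\<infinity>t. cinner (f t) (g t)" .

lift_definition minus_ell2 :: "('a, 'b) ell2 \<Rightarrow> ('a, 'b) ell2 \<Rightarrow> ('a, 'b) ell2"
  is "\<lambda>f g t. f t - g t" by (rule square_summable_diff)

lift_definition uminus_ell2 :: "('a, 'b) ell2 \<Rightarrow> ('a, 'b) ell2"
  is "\<lambda>f t. - f t" by (rule square_summable_uminus)

lift_definition zero_ell2 :: "('a, 'b) ell2" is "\<lambda>t. 0"
  by (simp add: square_summable_def)

lift_definition plus_ell2 :: "('a, 'b) ell2 \<Rightarrow> ('a, 'b) ell2 \<Rightarrow> ('a, 'b) ell2"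
  is "\<lambda>f g t. f t + g t" by (rule square_summable_add)

lift_definition scaleC_ell2 :: "complex \<Rightarrow> ('a, 'b) ell2 \<Rightarrow> ('a, 'b) ell2"
  is "\<lambda>c f t. c *\<^sub>C f t" by (rule square_summable_scaleC)

definition scaleR_ell2 :: "real \<Rightarrow> ('a, 'b) ell2 \<Rightarrow> ('a, 'b) ell2" where
  "scaleR_ell2 r \<xi> = complex_of_real r *\<^sub>C \<xi>"

definition dist_ell2 :: "('a, 'b) ell2 \<Rightarrow> ('a, 'b) ell2 \<Rightarrow> real" where
  "dist_ell2 \<xi> \<eta> = norm (\<xi> - \<eta>)"

definition
  "(uniformity :: (('a, 'b) ell2 \<times> ('a, 'b) ell2) filter) =
     (INF e\<in>{0 <..}. principal {(x, y). dist x y < e})"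

definition open_ell2 :: "('a, 'b) ell2 set \<Rightarrow> bool" where
  "open_ell2 S = (\<forall>x\<in>S. \<forall>\<^sub>F (x', y) in uniformity. x' = x \<longrightarrow> y \<in> S)"

definition sgn_ell2 :: "('a, 'b) ell2 \<Rightarrow> ('a, 'b) ell2" where
  "sgn_ell2 \<xi> = inverse (norm \<xi>) *\<^sub>R \<xi>"

instance
proof
  fix x y z :: "('a, 'b) ell2" and c d :: complex and r r' :: real
  show "dist x y = norm (x - y)" by (rule dist_ell2_def)
  show "(uniformity :: (('a, 'b) ell2 \<times> ('a, 'b) ell2) filter)
      = (INF e\<in>{0 <..}. principal {(x, y). dist x y < e})"
    by (rule uniformity_ell2_def)
  show "open A = (\<forall>x\<in>A. \<forall>\<^sub>F (x', y) in uniformity. x' = x \<longrightarrow> y \<in> A)" for A :: "('a, 'b) ell2 set"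
    by (rule open_ell2_def)
  show "sgn x = inverse (norm x) *\<^sub>R x" by (rule sgn_ell2_def)
  show "x + y + z = x + (y + z)" by transfer (simp add: algebra_simps)
  show "x + y = y + x" by transfer (simp add: algebra_simps)
  show "0 + x = x" by transfer simp
  show "- x + x = 0" by transfer simp
  show "x - y = x + - y" by transfer simp
  show "c *\<^sub>C (x + y) = c *\<^sub>C x + c *\<^sub>C y" by transfer (simp add: scaleC_add_right)
  show "(c + d) *\<^sub>C x = c *\<^sub>C x + d *\<^sub>C x" by transfer (simp add: scaleC_add_left)
  show "c *\<^sub>C d *\<^sub>C x = (c * d) *\<^sub>C x" by transfer simp
  show "r *\<^sub>R x = complex_of_real r *\<^sub>C x" by (rule scaleR_ell2_def)
  show "r *\<^sub>R (x + y) = r *\<^sub>R x + r *\<^sub>R y"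
    unfolding scaleR_ell2_def by transfer (simp add: scaleC_add_right)
  show "(r + r') *\<^sub>R x = r *\<^sub>R x + r' *\<^sub>R x"
    unfolding scaleR_ell2_def by transfer (simp add: scaleC_add_left)
  show "r *\<^sub>R r' *\<^sub>R x = (r * r') *\<^sub>R x"
    unfolding scaleR_ell2_def by transfer simp
  show "1 *\<^sub>R x = x"
    unfolding scaleR_ell2_def by transfer simp
  show "(norm x = 0) = (x = 0)"
  proof
    assume "norm x = 0"
    then have "norm (x t) \<le> 0" for t
      using norm_le_l2norm[OF square_summable_ell2, of x t] by (simp add: norm_ell2.rep_eq)
    then show "x = 0" by (intro ell2_eqI) (simp add: zero_ell2.rep_eq)
  qed (simp add: norm_ell2.rep_eq zero_ell2.rep_eq l2norm_def)
  show "norm (x + y) \<le> norm x + norm y" by transfer (rule l2norm_triangle)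
  show nC: "norm (c *\<^sub>C x) = cmod c * norm x" for c by transfer (rule l2norm_scaleC)
  show "norm (r *\<^sub>R x) = \<bar>r\<bar> * norm x"
    unfolding scaleR_ell2_def by (simp add: nC)
  show "cinner x y = cnj (cinner y x)"
  proof -
    have "cnj (\<Sum>\<^sub>\<infinity>t. cinner (y t) (x t)) = (\<Sum>\<^sub>\<infinity>t. cnj (cinner (y t) (x t)))"
      by (rule infsum_cnj[symmetric])
    also have "\<dots> = (\<Sum>\<^sub>\<infinity>t. cinner (x t) (y t))"
      by (intro infsum_cong cinner_commute[symmetric])
    finally show ?thesis unfolding cinner_ell2.rep_eq by (rule sym)
  qed
  show "cinner (x + y) z = cinner x z + cinner y z"
    by transfer (simp add: cinner_add_left infsum_add summable_cinner)
  show "cinner (c *\<^sub>C x) y = c * cinner x y"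
    by transfer (simp add: cinner_scaleC_left infsum_cmult_right')
  show "cinner x x = complex_of_real ((norm x)\<^sup>2)"
  proof -
    have "(\<Sum>\<^sub>\<infinity>t. complex_of_real ((norm (x t))\<^sup>2)) = complex_of_real (\<Sum>\<^sub>\<infinity>t. (norm (x t))\<^sup>2)"
      using square_summable_ell2[of x] unfolding square_summable_def
      by (intro infsumI has_sum_of_real has_sum_infsum)
    then show ?thesis
      unfolding cinner_ell2.rep_eq norm_ell2.rep_eq l2norm_def cinner_self
      by (simp only: real_sqrt_pow2 infsum_nonneg zero_le_power2)
  qed
qed

end

instance ell2 :: (type, chilbert_space) chilbert_space
proof
  fix X :: "nat \<Rightarrow> ('a, 'b) ell2"
  assume X: "Cauchy X"
  have le: "norm (x t - y t) \<le> norm (x - y)" for x y :: "('a, 'b) ell2" and t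
    using norm_le_l2norm[OF square_summable_ell2, of "x - y" t]
    by (simp add: norm_ell2.rep_eq minus_ell2.rep_eq)
  have "Cauchy (\<lambda>n. X n t)" for t
  proof (rule CauchyI)
    fix e :: real assume "0 < e"
    from CauchyD[OF X this] obtain M where "\<forall>m\<ge>M. \<forall>n\<ge>M. norm (X m - X n) < e" by blast
    then show "\<exists>M. \<forall>m\<ge>M. \<forall>n\<ge>M. norm (X m t - X n t) < e" using le order_le_less_trans by blast
  qed
  then have "\<forall>t. \<exists>l. (\<lambda>n. X n t) \<longlonglongrightarrow> l" using Cauchy_convergent_iff convergent_def by blast
  then obtain f where f: "\<And>t. (\<lambda>n. X n t) \<longlonglongrightarrow> f t" by metis
  have close: "\<exists>M. \<forall>m\<ge>M. square_summable (\<lambda>t. X m t - f t) \<and> l2norm (\<lambda>t. X m t - f t) \<le> e"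
    if e: "0 < e" for e
  proof -
    from CauchyD[OF X e] obtain M where M: "\<And>m n. m \<ge> M \<Longrightarrow> n \<ge> M \<Longrightarrow> norm (X m - X n) < e" by blast
    have bound: "L2_set (\<lambda>t. norm (X m t - f t)) F \<le> e" if m: "m \<ge> M" and F: "finite F" for m F
    proof (rule LIMSEQ_le_const2)
      show "(\<lambda>n. L2_set (\<lambda>t. norm (X m t - X n t)) F) \<longlonglongrightarrow> L2_set (\<lambda>t. norm (X m t - f t)) F"
        unfolding L2_set_def by (intro tendsto_intros f)
      have "L2_set (\<lambda>t. norm (X m t - X n t)) F \<le> e" if "n \<ge> M" for n
        using L2_set_le_l2norm[OF square_summable_ell2 F, of "X m - X n"] M[OF m that]
        by (simp add: norm_ell2.rep_eq minus_ell2.rep_eq)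
      then show "\<exists>N. \<forall>n\<ge>N. L2_set (\<lambda>t. norm (X m t - X n t)) F \<le> e" by blast
    qed
    show ?thesis using square_summable_bound[OF bound] by blast
  qed
  obtain m where m: "square_summable (\<lambda>t. X m t - f t)" using close[of 1] by auto
  have "square_summable (\<lambda>t. X m t - (X m t - f t))"
    by (rule square_summable_diff[OF square_summable_ell2 m])
  then have f2: "ell2_apply (Ell2 f) = f" by (simp add: Ell2_inverse)
  have "X \<longlonglongrightarrow> Ell2 f"
  proof (rule LIMSEQ_I)
    fix e :: real assume e: "0 < e"
    then obtain M where M: "\<forall>m\<ge>M. l2norm (\<lambda>t. X m t - f t) \<le> e / 2" using close[of "e / 2"] by auto
    have "norm (X m - Ell2 f) < e" if "m \<ge> M" for m
    proof -
      have "norm (X m - Ell2 f) = l2norm (\<lambda>t. X m t - f t)"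
        by (simp add: norm_ell2.rep_eq minus_ell2.rep_eq f2)
      then show ?thesis using M that e by fastforce
    qed
    then show "\<exists>M. \<forall>m\<ge>M. norm (X m - Ell2 f) < e" by blast
  qed
  then show "convergent X" by (rule convergentI)
qed

lift_definition delta :: "'g \<Rightarrow> 'h \<Rightarrow> ('g, 'h::complex_inner) ell2"
  is "\<lambda>s v t. if t = s then v else 0"
proof -
  fix s :: 'g and v :: 'h
  show "square_summable (\<lambda>t. if t = s then v else 0)"
    unfolding square_summable_def
    by (rule summable_on_cong_neutral[where T = "{s}", THEN iffD2]) auto
qed

lemma square_summable_diagonal:
  fixes D :: "'g \<Rightarrow> 'h::complex_normed_vector bop" and f :: "'g \<Rightarrow> 'h"
  assumes D: "\<And>t. norm (D t) \<le> K" and f: "square_summable f"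
  shows "square_summable (\<lambda>t. D t (f t))" and "l2norm (\<lambda>t. D t (f t)) \<le> K * l2norm f"
proof -
  have K: "0 \<le> K" using D norm_ge_zero order_trans by blast
  have "L2_set (\<lambda>t. norm (D t (f t))) F \<le> K * l2norm f" if "finite F" for F
  proof -
    have "norm (D t (f t)) \<le> K * norm (f t)" for t
      using norm_bop[of "D t" "f t"] mult_right_mono[OF D[of t] norm_ge_zero[of "f t"]] by linarith
    then have "L2_set (\<lambda>t. norm (D t (f t))) F \<le> L2_set (\<lambda>t. K * norm (f t)) F"
      by (intro L2_set_mono) auto
    also have "\<dots> = K * L2_set (\<lambda>t. norm (f t)) F" using K by (simp add: L2_set_right_distrib)
    also have "\<dots> \<le> K * l2norm f" using K by (intro mult_left_mono L2_set_le_l2norm f that)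
    finally show ?thesis .
  qed
  from square_summable_bound[OF this]
  show "square_summable (\<lambda>t. D t (f t))" "l2norm (\<lambda>t. D t (f t)) \<le> K * l2norm f" by auto
qed


section \<open>Groups, actions and stationary states\<close>

text \<open>Groups are the types of class \<^class>\<open>group_add\<close>, which is not assumed commutative. The group
  law is written additively: \<open>s + t\<close>, \<open>- s\<close>, \<open>0\<close> stand for \<open>st\<close>, \<open>s\<^sup>-\<^sup>1\<close>, \<open>e\<close>.\<close>

definition action :: "('g::group_add \<Rightarrow> 'a::cstar_algebra \<Rightarrow> 'a) \<Rightarrow> bool" where
  "action \<alpha> \<longleftrightarrow> (\<forall>s. star_hom (\<alpha> s) \<and> bij (\<alpha> s)) \<and> \<alpha> 0 = id \<and> (\<forall>s t. \<alpha> (s + t) = \<alpha> s \<circ> \<alpha> t)"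

definition translate_state ::
  "('g::group_add \<Rightarrow> 'a \<Rightarrow> 'a) \<Rightarrow> 'g \<Rightarrow> ('a \<Rightarrow> complex) \<Rightarrow> 'a \<Rightarrow> complex" where
  "translate_state \<alpha> s \<tau> a = \<tau> (\<alpha> (- s) a)"

definition convolve ::
  "('g::group_add \<Rightarrow> 'a \<Rightarrow> 'a) \<Rightarrow> 'g pmf \<Rightarrow> ('a \<Rightarrow> complex) \<Rightarrow> 'a \<Rightarrow> complex" where
  "convolve \<alpha> \<mu> \<tau> a = (\<Sum>\<^sub>\<infinity>s. complex_of_real (pmf \<mu> s) * translate_state \<alpha> s \<tau> a)"

definition stationary_on ::
  "'a set \<Rightarrow> ('g::group_add \<Rightarrow> 'a \<Rightarrow> 'a) \<Rightarrow> 'g pmf \<Rightarrow> ('a \<Rightarrow> complex) \<Rightarrow> bool" where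
  "stationary_on B \<alpha> \<mu> \<tau> \<longleftrightarrow> (\<forall>a\<in>B. convolve \<alpha> \<mu> \<tau> a = \<tau> a)"


section \<open>The reduced group \<open>C\<^sup>*\<close>-algebra\<close>

definition left_translation :: "'g::group_add \<Rightarrow> ('g, 'h::complex_inner) ell2 bop" where
  "left_translation s = Bop (\<lambda>\<xi> :: ('g, 'h) ell2. Ell2 (\<lambda>t. \<xi> (- s + t)))"

lemma left_translation_apply:
  fixes s :: "'g::group_add" and \<xi> :: "('g, 'h::complex_inner) ell2"
  shows "ell2_apply (bop_apply (left_translation s) \<xi>) t = ell2_apply \<xi> (- s + t)"
proof -
  have bij: "bij (\<lambda>t. - s + t)" by (rule bij_plus)
  have sum: "square_summable (\<lambda>t. \<xi> (- s + t))" for \<xi> :: "('g, 'h) ell2"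
    using square_summable_ell2[of \<xi>] summable_on_reindex_bij_betw[OF bij, of "\<lambda>t. (norm (\<xi> t))\<^sup>2"]
    by (simp add: square_summable_def)
  define L where "L \<xi> = Ell2 (\<lambda>t. ell2_apply \<xi> (- s + t))" for \<xi> :: "('g, 'h) ell2"
  have L: "ell2_apply (L \<xi>) = (\<lambda>t. \<xi> (- s + t))" for \<xi>
    by (simp add: L_def Ell2_inverse sum)
  have "norm (L \<xi>) = norm \<xi>" for \<xi>
    using infsum_reindex_bij_betw[OF bij, of "\<lambda>t. (norm (\<xi> t))\<^sup>2"]
    by (simp add: norm_ell2.rep_eq L l2norm_def)
  moreover have LC: "L (c *\<^sub>C \<xi>) = c *\<^sub>C L \<xi>" for c \<xi>
    by (rule ell2_eqI) (simp add: L scaleC_ell2.rep_eq)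
  moreover have "L (\<xi> + \<eta>) = L \<xi> + L \<eta>" for \<xi> \<eta>
    by (rule ell2_eqI) (simp add: L plus_ell2.rep_eq)
  ultimately have "bounded_linear L"
    by (intro bounded_linear_intro[where K = 1]) (auto simp: scaleR_scaleC)
  then have "bop_apply (Bop L) = L" by (simp add: Bop_inverse LC)
  then show ?thesis by (simp add: left_translation_def L flip: L_def)
qed

definition inner_action ::
  "'g::group_add \<Rightarrow> ('g, 'h::chilbert_space) ell2 bop \<Rightarrow> ('g, 'h) ell2 bop" where
  "inner_action s x = left_translation s * x * star (left_translation s)"

definition reduced_cstar :: "('g::group_add, complex) ell2 bop set" where
  "reduced_cstar = cstar_generated (range left_translation)"

definition cstar_simple_group :: "'g::group_add itself \<Rightarrow> bool" where
  "cstar_simple_group _ \<longleftrightarrow> simple_cstar (reduced_cstar :: ('g, complex) ell2 bop set)"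

definition canonical_trace :: "('g::group_add, complex) ell2 bop \<Rightarrow> complex" where
  "canonical_trace x = cinner (x (delta 0 1)) (delta 0 1)"

lemma canonical_trace_left_translation:
  "canonical_trace (left_translation s) = (if s = 0 then 1 else 0)"
proof -
  have "cinner (ell2_apply (left_translation s (delta 0 (1 :: complex))) t) (ell2_apply (delta 0 1) t)
      = (if t = 0 then if s = 0 then 1 else 0 else (0 :: complex))" for t :: 'a
    by (simp add: left_translation_apply delta.rep_eq cinner_complex_def)
  then have "canonical_trace (left_translation s)
      = (\<Sum>\<^sub>\<infinity>t::'a. if t = 0 then if s = 0 then 1 else 0 else (0 :: complex))"
    by (simp add: canonical_trace_def cinner_ell2.rep_eq)
  also have "\<dots> = (\<Sum>\<^sub>\<infinity>t\<in>{0::'a}. if s = 0 then 1 else (0 :: complex))"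
    by (rule infsum_cong_neutral) auto
  finally show ?thesis by simp
qed

definition cstar_simple_measure :: "'g::group_add pmf \<Rightarrow> bool" where
  "cstar_simple_measure (\<mu> :: 'g pmf) \<longleftrightarrow>
     (let B = (reduced_cstar :: ('g, complex) ell2 bop set) in
       state_on B canonical_trace \<and> stationary_on B inner_action \<mu> canonical_trace \<and>
       (\<forall>\<tau>. state_on B \<tau> \<and> stationary_on B inner_action \<mu> \<tau> \<longrightarrow>
          (\<forall>x\<in>B. \<tau> x = canonical_trace x)))"


section \<open>Reduced crossed products\<close>

definition faithful_representation :: "('a::cstar_algebra \<Rightarrow> 'h::chilbert_space bop) \<Rightarrow> bool" where
  "faithful_representation \<pi> \<longleftrightarrow> star_hom \<pi> \<and> inj \<pi>"

text \<open>The operator below is bounded because \<open>*\<close>-homomorphisms of \<open>C\<^sup>*\<close>-algebras are contractive; see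
  \<open>crossed_embedding_apply\<close>.\<close>

definition crossed_embedding ::
  "('g::group_add \<Rightarrow> 'a::cstar_algebra \<Rightarrow> 'a) \<Rightarrow> ('a \<Rightarrow> 'h::chilbert_space bop) \<Rightarrow> 'a \<Rightarrow>
    ('g, 'h) ell2 bop" where
  "crossed_embedding \<alpha> \<pi> a = Bop (\<lambda>\<xi> :: ('g, 'h) ell2. Ell2 (\<lambda>t. \<pi> (\<alpha> (- t) a) (\<xi> t)))"

lemma crossed_embedding_apply:
  fixes \<alpha> :: "'g::group_add \<Rightarrow> 'a::cstar_algebra \<Rightarrow> 'a"
    and \<pi> :: "'a \<Rightarrow> 'h::chilbert_space bop" and \<xi> :: "('g, 'h) ell2"
  assumes K: "\<And>t. norm (\<pi> (\<alpha> (- t) a)) \<le> K"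
  shows "ell2_apply (bop_apply (crossed_embedding \<alpha> \<pi> a) \<xi>) t = bop_apply (\<pi> (\<alpha> (- t) a)) (ell2_apply \<xi> t)"
proof -
  define L where "L \<xi> = Ell2 (\<lambda>t. \<pi> (\<alpha> (- t) a) (ell2_apply \<xi> t))" for \<xi> :: "('g, 'h) ell2"
  have L: "ell2_apply (L \<xi>) = (\<lambda>t. \<pi> (\<alpha> (- t) a) (ell2_apply \<xi> t))" for \<xi>
    by (simp add: L_def Ell2_inverse square_summable_diagonal[OF K square_summable_ell2])
  have "norm (L \<xi>) \<le> norm \<xi> * K" for \<xi>
    using square_summable_diagonal(2)[where f = "ell2_apply \<xi>", OF K square_summable_ell2]
    by (simp add: norm_ell2.rep_eq L mult.commute)
  moreover have LC: "L (c *\<^sub>C \<xi>) = c *\<^sub>C L \<xi>" for c \<xi>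
    by (rule ell2_eqI) (simp add: L scaleC_ell2.rep_eq bop_scaleC)
  moreover have "L (\<xi> + \<eta>) = L \<xi> + L \<eta>" for \<xi> \<eta>
    by (rule ell2_eqI)
      (simp add: L plus_ell2.rep_eq linear_add[OF bounded_linear.linear[OF bounded_linear_bop]])
  ultimately have "bounded_linear L"
    by (intro bounded_linear_intro[where K = K]) (auto simp: scaleR_scaleC)
  then have "bop_apply (Bop L) = L" by (simp add: Bop_inverse LC)
  then show ?thesis by (simp add: crossed_embedding_def L flip: L_def)
qed

definition crossed_product ::
  "('g::group_add \<Rightarrow> 'a::cstar_algebra \<Rightarrow> 'a) \<Rightarrow> ('a \<Rightarrow> 'h::chilbert_space bop) \<Rightarrow>
    ('g, 'h) ell2 bop set" where
  "crossed_product \<alpha> \<pi> = cstar_generated (range left_translation \<union> range (crossed_embedding \<alpha> \<pi>))"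

text \<open>Restricting to functions that are \<^const>\<open>undefined\<close> outside the crossed product is what makes
  the function unique.\<close>

definition canonical_expectation ::
  "('g::group_add \<Rightarrow> 'a::cstar_algebra \<Rightarrow> 'a) \<Rightarrow> ('a \<Rightarrow> 'h::chilbert_space bop) \<Rightarrow>
    ('g, 'h) ell2 bop \<Rightarrow> ('g, 'h) ell2 bop" where
  "canonical_expectation \<alpha> \<pi> = (THE E.
     E \<in> extensional (crossed_product \<alpha> \<pi>) \<and>
     conditional_expectation (crossed_product \<alpha> \<pi>) (range (crossed_embedding \<alpha> \<pi>)) E \<and>
     (\<forall>a. E (crossed_embedding \<alpha> \<pi> a) = crossed_embedding \<alpha> \<pi> a) \<and>
     (\<forall>a s. s \<noteq> 0 \<longrightarrow> E (crossed_embedding \<alpha> \<pi> a * left_translation s) = 0))"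

end

theory Submission
  imports Defs
begin

text \<open>It suffices that a \<open>\<mu>\<close>-stationary state vanishes on \<open>\<sigma>(a)\<lambda>\<^sub>s\<close> for \<open>s \<noteq> e\<close>. Unique stationarity of the trace makes the Cesaro averages of \<open>\<lambda>\<^sub>s\<close> under \<open>\<mu>\<close> tend to zero in
  norm: otherwise vector states that do not vanish on them accumulate at a second stationary state. The
  averages of \<open>\<sigma>(a)\<lambda>\<^sub>s\<close> are sums \<open>\<Sum> c\<^sub>t \<sigma>(ta) \<lambda>(tst\<^sup>-\<^sup>1)\<close> with \<open>c\<^sub>t \<ge> 0\<close>, and pointwise on \<open>\<ell>\<^sup>2(\<Gamma>, H)\<close> such a sum is
  dominated by \<open>\<parallel>a\<parallel>\<close> times the same average of \<open>\<lambda>\<^sub>s\<close> applied to \<open>t \<mapsto> \<parallel>\<xi>(t)\<parallel>\<close>. So they tend to zero as well,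
  while stationarity keeps the value of the state on them constant.

  The canonical expectation is compression to the block diagonal. That it takes values in \<open>\<sigma>(\<A>)\<close> and maps
  \<open>x\<^sup>*x\<close> to some \<open>y\<^sup>*y\<close> needs \<open>\<sigma>\<close> to be isometric and to reflect positivity; both follow from the
  binomial series of the square root, without spectral theory.\<close>

section \<open>Square roots in a \<open>C\<^sup>*\<close>-algebra\<close>

lemma star_one [simp]: "star 1 = (1 :: 'a::cstar_algebra)"
  by (metis mult.left_neutral mult.right_neutral star_mult star_star)

lemma star_minus: "star (- x) = - star (x :: 'a::cstar_algebra)"
  using star_scaleC[of "-1" x] by simp

lemma star_diff: "star (x - y) = star x - star (y :: 'a::cstar_algebra)"
  using star_add[of x "- y"] by (simp add: star_minus)

lemma star_scaleR: "star (r *\<^sub>R x) = r *\<^sub>R star (x :: 'a::cstar_algebra)"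
  by (simp add: scaleR_scaleC star_scaleC)

lemma star_power: "star (x ^ n) = star (x :: 'a::cstar_algebra) ^ n"
  by (induction n) (simp_all add: star_mult power_commutes)

text \<open>The \<open>C*\<close>-identity and submultiplicativity give
  \<open>norm y * norm y \<le> norm (star y) * norm y\<close>; cancelling, and then replacing
  \<open>y\<close> by its adjoint, yields both inequalities.\<close>

lemma norm_star [simp]: "norm (star x) = norm (x :: 'a::cstar_algebra)"
proof -
  have le: "norm y \<le> norm (star y)" for y :: 'a
  proof (cases "norm y = 0")
    case False
    have "norm y * norm y \<le> norm (star y) * norm y"
      using norm_mult_ineq[of "star y" y] by (simp add: cstar_identity power2_eq_square)
    then show ?thesis using False by (simp add: mult_le_cancel_right)
  qed simp
  show ?thesis using le[of x] le[of "star x"] by simp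
qed

lemma bounded_linear_star: "bounded_linear (star :: 'a::cstar_algebra \<Rightarrow> 'a)"
  by (rule bounded_linear_intro[where K = 1]) (simp_all add: star_add star_scaleR)

text \<open>Only an inequality can be expected: in the zero algebra the unit has norm 0.\<close>

lemma norm_one_le: "norm (1 :: 'a::cstar_algebra) \<le> 1"
proof -
  have "(norm (1 :: 'a))\<^sup>2 = norm (1 :: 'a)" using cstar_identity[of "1 :: 'a"] by simp
  then have "1 = (0 :: 'a) \<or> norm (1 :: 'a) = 1" by (simp add: power2_eq_square)
  then show ?thesis by (auto dest: arg_cong[where f = norm])
qed

lemma norm_power_le_one: "norm (x :: 'a::cstar_algebra) \<le> 1 \<Longrightarrow> norm (x ^ n) \<le> 1"
proof (induction n)
  case 0
  then show ?case by (simp add: norm_one_le)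
next
  case (Suc n)
  have "norm (x * x ^ n) \<le> norm x * norm (x ^ n)" by (rule norm_mult_ineq)
  also have "\<dots> \<le> 1" using Suc by (simp add: mult_le_one)
  finally show ?case by simp
qed

lemma norm_square_selfadjoint: "star x = x \<Longrightarrow> norm (x * x) = (norm (x :: 'a::cstar_algebra))\<^sup>2"
  using cstar_identity[of x] by simp

lemma norm_le_one_if_star_mult_one: "star u * u = 1 \<Longrightarrow> norm (u :: 'a::cstar_algebra) \<le> 1"
  using cstar_identity[of u] norm_one_le[where 'a = 'a] by (simp add: power_le_one_iff)

section \<open>Taylor coefficients of \<open>sqrt (1 - x)\<close> at 0 and the resulting
  series\<close>

definition sqrt_coeff :: "nat \<Rightarrow> real" where
  "sqrt_coeff n = (1/2 gchoose n) * (-1) ^ n"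

lemma sqrt_coeff_0 [simp]: "sqrt_coeff 0 = 1"
  by (simp add: sqrt_coeff_def)

text \<open>Splitting the factor \<open>- 1 / 2\<close> off the rising factorial leaves one with
  positive base.\<close>

lemma sqrt_coeff_Suc_nonpos: "sqrt_coeff (Suc n) \<le> 0"
proof -
  have eq: "sqrt_coeff (Suc n) = (- 1 / 2) * pochhammer (1/2) n / fact (Suc n)"
    by (simp add: sqrt_coeff_def gbinomial_pochhammer pochhammer_rec del: fact_Suc)
  show ?thesis unfolding eq
    by (intro divide_nonpos_pos mult_nonpos_nonneg pochhammer_nonneg) auto
qed

text \<open>Alternating sums of the binomials of 1/2 have a closed form in the binomials of -1/2,
  whose signs cancel against the powers of -1.\<close>

lemma sum_sqrt_coeff_nonneg: "0 \<le> (\<Sum>k\<le>n. sqrt_coeff k)"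
proof -
  have eq: "(\<Sum>k\<le>n. sqrt_coeff k) = pochhammer (1/2) n / fact n"
    unfolding sqrt_coeff_def gbinomial_sum_lower_neg
    by (simp add: gbinomial_pochhammer power_add[symmetric] mult_2[symmetric])
  show ?thesis unfolding eq
    by (intro divide_nonneg_nonneg pochhammer_nonneg) auto
qed

text \<open>All coefficients after the constant term 1 are nonpositive, so this sum equals 1 minus a
  partial sum, and partial sums are nonnegative.\<close>

lemma sum_abs_sqrt_coeff_le: "(\<Sum>k<n. \<bar>sqrt_coeff (Suc k)\<bar>) \<le> 1"
proof -
  have "(\<Sum>k\<le>n. sqrt_coeff k) = 1 + (\<Sum>k<n. sqrt_coeff (Suc k))"
    unfolding lessThan_Suc_atMost[symmetric] sum.lessThan_Suc_shift by simp
  moreover have "\<bar>sqrt_coeff (Suc k)\<bar> = - sqrt_coeff (Suc k)" for k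
    using sqrt_coeff_Suc_nonpos[of k] by simp
  ultimately show ?thesis using sum_sqrt_coeff_nonneg[of n] by (simp add: sum_negf)
qed

lemma summable_abs_sqrt_coeff: "summable (\<lambda>n. \<bar>sqrt_coeff n\<bar>)"
proof -
  have "summable (\<lambda>n. \<bar>sqrt_coeff (Suc n)\<bar>)"
    by (rule summableI_nonneg_bounded[where x = 1]) (simp_all add: sum_abs_sqrt_coeff_le)
  then show ?thesis by (subst (asm) summable_Suc_iff)
qed

text \<open>This is the coefficientwise form of \<open>sqrt (1 - x) * sqrt (1 - x) = 1 - x\<close>.
  Vandermonde adds the exponents 1/2 and 1/2 to 1.\<close>

lemma sqrt_coeff_convolution:
  "(\<Sum>i\<le>n. sqrt_coeff i * sqrt_coeff (n - i)) = (if n = 0 then 1 else if n = 1 then -1 else 0)"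
proof -
  have "(\<Sum>i\<le>n. sqrt_coeff i * sqrt_coeff (n - i))
      = (\<Sum>i\<le>n. (1/2 gchoose i) * (1/2 gchoose (n - i)) * (-1) ^ n)"
    by (rule sum.cong) (auto simp: sqrt_coeff_def power_add[symmetric])
  also have "\<dots> = (\<Sum>i=0..n. (1/2 gchoose i) * (1/2 gchoose (n - i))) * (-1) ^ n"
    by (simp add: sum_distrib_right atMost_atLeast0)
  also have "\<dots> = ((1::real) gchoose n) * (-1) ^ n"
    by (subst gbinomial_Vandermonde) simp
  also have "\<dots> = (real (1 choose n)) * (-1) ^ n"
    using binomial_gbinomial[of 1 n, where ?'a = real] by simp
  also have "\<dots> = (if n = 0 then 1 else if n = 1 then -1 else 0)"
    by (auto simp: binomial_eq_0)
  finally show ?thesis .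
qed

text \<open>The binomial series of \<open>\<surd>(1 - v)\<close>; since its coefficients are absolutely summable, it converges
  on the closed unit ball.\<close>

definition sqrt_one_minus :: "'a::cstar_algebra \<Rightarrow> 'a" where
  "sqrt_one_minus v = (\<Sum>n. sqrt_coeff n *\<^sub>R v ^ n)"

context
  fixes v :: "'a::cstar_algebra"
  assumes v: "norm v \<le> 1"
begin

lemma summable_norm_sqrt_series: "summable (\<lambda>n. norm (sqrt_coeff n *\<^sub>R v ^ n))"
  by (rule summable_comparison_test[OF _ summable_abs_sqrt_coeff])
    (auto simp: mult_left_le[OF norm_power_le_one[OF v]])

lemma summable_sqrt_series: "summable (\<lambda>n. sqrt_coeff n *\<^sub>R v ^ n)"
  using summable_norm_sqrt_series by (rule summable_norm_cancel)

lemma sqrt_one_minus_square: "sqrt_one_minus v * sqrt_one_minus v = 1 - v"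
proof -
  have coeff: "(\<Sum>i\<le>n. (sqrt_coeff i *\<^sub>R v ^ i) * (sqrt_coeff (n - i) *\<^sub>R v ^ (n - i)))
      = (if n = 0 then 1 else if n = 1 then - v else 0)" for n
  proof -
    have "(\<Sum>i\<le>n. (sqrt_coeff i *\<^sub>R v ^ i) * (sqrt_coeff (n - i) *\<^sub>R v ^ (n - i)))
        = (\<Sum>i\<le>n. (sqrt_coeff i * sqrt_coeff (n - i)) *\<^sub>R v ^ n)"
      by (rule sum.cong) (auto simp: power_add[symmetric])
    also have "\<dots> = (if n = 0 then 1 else if n = 1 then -1 else 0) *\<^sub>R v ^ n"
      by (simp only: sqrt_coeff_convolution scaleR_sum_left[symmetric])
    finally show ?thesis by auto
  qed
  have "(\<lambda>n. if n = 0 then 1 else if n = 1 then - v else 0) sums (sqrt_one_minus v * sqrt_one_minus v)"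
    using Cauchy_product_sums[OF summable_norm_sqrt_series summable_norm_sqrt_series]
    unfolding coeff sqrt_one_minus_def .
  moreover have "(\<lambda>n. if n = 0 then 1 else if n = 1 then - v else 0)
      sums (\<Sum>n\<in>{0, 1 :: nat}. if n = 0 then 1 else if n = 1 then - v else 0)"
    by (rule sums_finite) auto
  ultimately show ?thesis by (auto dest: sums_unique2)
qed

lemma star_sqrt_one_minus: "star v = v \<Longrightarrow> star (sqrt_one_minus v) = sqrt_one_minus v"
  unfolding sqrt_one_minus_def
  by (simp add: bounded_linear.suminf[OF bounded_linear_star summable_sqrt_series] star_scaleR star_power)

lemma sqrt_one_minus_commute:
  assumes "x * v = v * x"
  shows "x * sqrt_one_minus v = sqrt_one_minus v * x"
proof -
  have "x * v ^ n = v ^ n * x" for n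
    by (induction n) (simp_all, metis assms mult.assoc)
  then show ?thesis unfolding sqrt_one_minus_def
    by (simp add: suminf_mult[OF summable_sqrt_series, symmetric] 
       suminf_mult2[OF summable_sqrt_series])
qed

text \<open>The unit cancels the constant term, and the remaining coefficients have absolute sum at
  most 1. Hence the series can be applied a second time, at
  \<open>1 - sqrt_one_minus v\<close>.\<close>

lemma norm_one_diff_sqrt_one_minus: "norm (1 - sqrt_one_minus v) \<le> 1"
proof -
  have "sqrt_one_minus v = 1 + (\<Sum>n. sqrt_coeff (Suc n) *\<^sub>R v ^ Suc n)"
    unfolding sqrt_one_minus_def using suminf_split_head[OF summable_sqrt_series] by simp
  then have "norm (1 - sqrt_one_minus v) = norm (\<Sum>n. sqrt_coeff (Suc n) *\<^sub>R v ^ Suc n)" by simp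
  also have "\<dots> \<le> (\<Sum>n. norm (sqrt_coeff (Suc n) *\<^sub>R v ^ Suc n))"
    by (rule summable_norm) (use summable_norm_sqrt_series in \<open>subst summable_Suc_iff\<close>)
  also have "\<dots> \<le> 1"
  proof (rule suminf_le_const)
    show "summable (\<lambda>n. norm (sqrt_coeff (Suc n) *\<^sub>R v ^ Suc n))"
      using summable_norm_sqrt_series by (subst summable_Suc_iff)
    show "(\<Sum>k<n. norm (sqrt_coeff (Suc k) *\<^sub>R v ^ Suc k)) \<le> 1" for n
    proof -
      have "(\<Sum>k<n. norm (sqrt_coeff (Suc k) *\<^sub>R v ^ Suc k)) \<le> (\<Sum>k<n. \<bar>sqrt_coeff (Suc k)\<bar>)"
        unfolding norm_scaleR
        by (intro sum_mono mult_left_le norm_power_le_one[OF v]) auto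
      then show ?thesis using sum_abs_sqrt_coeff_le[of n] by linarith
    qed
  qed
  finally show ?thesis .
qed

end

section \<open>Subalgebras, and norm bounds obtained from square roots\<close>

lemma subalgebra_closed: "cstar_subalgebra B \<Longrightarrow> closed B"
  and subalgebra_zero: "cstar_subalgebra B \<Longrightarrow> 0 \<in> B"
  and subalgebra_add: "cstar_subalgebra B \<Longrightarrow> x \<in> B \<Longrightarrow> y \<in> B \<Longrightarrow> x + y \<in> B"
  and subalgebra_scaleC: "cstar_subalgebra B \<Longrightarrow> x \<in> B \<Longrightarrow> c *\<^sub>C x \<in> B"
  and subalgebra_mult: "cstar_subalgebra B \<Longrightarrow> x \<in> B \<Longrightarrow> y \<in> B \<Longrightarrow> x * y \<in> B"
  and subalgebra_star: "cstar_subalgebra B \<Longrightarrow> x \<in> B \<Longrightarrow> star x \<in> B"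
  by (auto simp: cstar_subalgebra_def)

lemma subalgebra_scaleR: "cstar_subalgebra B \<Longrightarrow> x \<in> B \<Longrightarrow> r *\<^sub>R x \<in> B"
  by (simp add: scaleR_scaleC subalgebra_scaleC)

lemma subalgebra_diff: "cstar_subalgebra B \<Longrightarrow> x \<in> B \<Longrightarrow> y \<in> B \<Longrightarrow> x - y \<in> B"
  using subalgebra_add[of B x "(-1) *\<^sub>C y"] subalgebra_scaleC[of B y "-1"] by simp

lemma subalgebra_sum:
  "cstar_subalgebra B \<Longrightarrow> (\<And>i. i \<in> I \<Longrightarrow> f i \<in> B) \<Longrightarrow> sum f I \<in> B"
  by (induction I rule: infinite_finite_induct) (auto intro: subalgebra_zero subalgebra_add)

lemma sqrt_one_minus_in_subalgebra:
  assumes B: "cstar_subalgebra B" "1 \<in> B" and v: "v \<in> B" "norm v \<le> 1"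
  shows "sqrt_one_minus v \<in> B"
proof -
  have "v ^ n \<in> B" for n
    by (induction n) (auto intro: B v subalgebra_mult)
  then have "(\<Sum>k<n. sqrt_coeff k *\<^sub>R v ^ k) \<in> B" for n
    by (intro subalgebra_sum subalgebra_scaleR B)
  moreover have "(\<lambda>n. \<Sum>k<n. sqrt_coeff k *\<^sub>R v ^ k) \<longlonglongrightarrow> sqrt_one_minus v"
    unfolding sqrt_one_minus_def by (rule summable_LIMSEQ[OF summable_sqrt_series[OF v(2)]])
  ultimately show ?thesis
    by (rule closed_sequentially[OF subalgebra_closed[OF B(1)]])
qed

text \<open>The element \<open>u = h + i z\<close> satisfies \<open>star u * u = 1\<close>, hence
  has norm at most 1, and \<open>h\<close> and \<open>z\<close> are its real and imaginary
  parts.\<close>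

lemma norm_le_one_if_square_sum_one:
  fixes h z :: "'a::cstar_algebra"
  assumes h: "star h = h" and z: "star z = z" and comm: "h * z = z * h" and one: "h * h + z * z = 1"
  shows "norm h \<le> 1" and "norm z \<le> 1"
proof -
  define u where "u = h + \<i> *\<^sub>C z"
  have su: "star u = h - \<i> *\<^sub>C z"
    using scaleC_minus_right[of \<i> z]
    by (simp add: u_def star_add star_scaleC h z)
       (metis mult_minus1 scaleC_minus1 scaleC_scaleC uminus_add_conv_diff add.commute)
  have "star u * u = h * h - (\<i> * \<i>) *\<^sub>C (z * z)"
    using comm unfolding su
    by (simp add: u_def distrib_left left_diff_distrib mult_scaleC_left mult_scaleC_right
        scaleC_diff_right scaleC_add_right)
  also have "\<dots> = 1" using one by simp
  finally have u: "norm u \<le> 1" by (rule norm_le_one_if_star_mult_one)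
  then have su': "norm (star u) \<le> 1" by simp
  have "2 *\<^sub>R h = u + star u" "2 *\<^sub>R (\<i> *\<^sub>C z) = u - star u"
    unfolding su by (simp_all add: u_def scaleR_2)
  then have "2 * norm h \<le> 2" "2 * norm (\<i> *\<^sub>C z) \<le> 2"
    using norm_triangle_ineq[of u "star u"] norm_triangle_ineq4[of u "star u"] u su'
    by (metis (no_types, opaque_lifting) abs_numeral norm_scaleR order_trans add_mono one_add_one)+
  then show "norm h \<le> 1" "norm z \<le> 1" by simp_all
qed

text \<open>With \<open>y\<close> the square root of \<open>1 - k * k\<close>, the squares of
  \<open>k\<close> and \<open>y\<close> add up to 1, so \<open>norm y \<le> 1\<close>. The bound
  allows the series to be evaluated at \<open>1 - k * k\<close>, which produces the absolute value
  of \<open>k\<close>.\<close>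

lemma norm_one_minus_square_le:
  fixes k :: "'a::cstar_algebra"
  assumes "star k = k" "norm k \<le> 1"
  shows "norm (1 - k * k) \<le> 1"
proof -
  have kk: "norm (k * k) \<le> 1" using assms by (simp add: norm_square_selfadjoint power_le_one)
  define y where "y = sqrt_one_minus (k * k)"
  have y: "star y = y" "k * y = y * k" "y * y = 1 - k * k"
    unfolding y_def using assms kk
    by (auto simp: star_sqrt_one_minus star_mult sqrt_one_minus_square mult.assoc
        intro!: sqrt_one_minus_commute)
  have "norm y \<le> 1"
    by (rule norm_le_one_if_square_sum_one[of k y]) (simp_all add: assms y)
  then show ?thesis using norm_square_selfadjoint[OF y(1)] y(3) by (simp add: power_le_one)
qed

section \<open>States and positive operators\<close>

lemma cstar_subalgebra_UNIV: "cstar_subalgebra UNIV"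
  by (simp add: cstar_subalgebra_def)

section \<open>Inequalities for states on a unital subalgebra\<close>

context
  fixes B :: "'a::cstar_algebra set" and \<phi> :: "'a \<Rightarrow> complex"
  assumes B: "cstar_subalgebra B" "1 \<in> B" and \<phi>: "state_on B \<phi>"
begin

lemma state_add: "x \<in> B \<Longrightarrow> y \<in> B \<Longrightarrow> \<phi> (x + y) = \<phi> x + \<phi> y"
  and state_scaleC: "x \<in> B \<Longrightarrow> \<phi> (c *\<^sub>C x) = c * \<phi> x"
  and state_nonneg: "x \<in> B \<Longrightarrow> \<phi> (star x * x) \<in> \<real>\<^sub>\<ge>\<^sub>0"
  and state_one: "\<phi> 1 = 1"
  using \<phi> unfolding state_on_def by blast+

lemma state_scaleR: "x \<in> B \<Longrightarrow> \<phi> (r *\<^sub>R x) = complex_of_real r * \<phi> x"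
  by (simp add: scaleR_scaleC state_scaleC)

lemma state_diff: "x \<in> B \<Longrightarrow> y \<in> B \<Longrightarrow> \<phi> (x - y) = \<phi> x - \<phi> y"
  using state_add[of x "(-1) *\<^sub>C y"] state_scaleC[of y "-1"] subalgebra_scaleC[OF B(1), of y "-1"]
  by simp

lemma state_zero: "\<phi> 0 = 0"
  using state_scaleC[of 1 0] B by simp

lemma state_sum: "(\<And>i. i \<in> I \<Longrightarrow> f i \<in> B) \<Longrightarrow> \<phi> (sum f I) = (\<Sum>i\<in>I. \<phi> (f i))"
  by (induction I rule: infinite_finite_induct)
    (auto simp: state_zero state_add subalgebra_sum[OF B(1)])

text \<open>Positivity at \<open>x + c 1\<close>, expanded. The values 1 and i of \<open>c\<close>
  show that the state is hermitian; the value \<open>- \<phi> x\<close> gives the Cauchy-Schwarz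
  inequality.\<close>

lemma state_translate_square:
  assumes x: "x \<in> B"
  shows "\<phi> (star x * x) + c * \<phi> (star x) + cnj c * \<phi> x + cnj c * c \<in> \<real>\<^sub>\<ge>\<^sub>0"
proof -
  have mem: "star x \<in> B" "star x * x \<in> B" "\<And>c y. y \<in> B \<Longrightarrow> c *\<^sub>C y \<in> B" "\<And>y z. y \<in> B \<Longrightarrow> z \<in> B \<Longrightarrow> y + z \<in> B"
    using B x by (auto intro: subalgebra_star subalgebra_mult subalgebra_scaleC subalgebra_add)
  have "star (x + c *\<^sub>C 1) * (x + c *\<^sub>C 1)
      = star x * x + c *\<^sub>C star x + cnj c *\<^sub>C x + (cnj c * c) *\<^sub>C 1"
    by (simp add: star_add star_scaleC distrib_left distrib_right mult_scaleC_left mult_scaleC_right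
        scaleC_add_right mult.commute)
  then have "\<phi> (star (x + c *\<^sub>C 1) * (x + c *\<^sub>C 1))
      = \<phi> (star x * x) + c * \<phi> (star x) + cnj c * \<phi> x + cnj c * c"
    using B x by (simp add: state_add state_scaleC state_one mem)
  then show ?thesis using state_nonneg[of "x + c *\<^sub>C 1"] B x mem by simp
qed

lemma state_star:
  assumes x: "x \<in> B"
  shows "\<phi> (star x) = cnj (\<phi> x)"
proof -
  have "\<phi> (star x * x) \<in> \<real>\<^sub>\<ge>\<^sub>0" using x by (rule state_nonneg)
  moreover have "\<phi> (star x * x) + \<phi> (star x) + \<phi> x + 1 \<in> \<real>\<^sub>\<ge>\<^sub>0"
    using state_translate_square[OF x, of 1] by simp
  moreover have "\<phi> (star x * x) + \<i> * \<phi> (star x) - \<i> * \<phi> x + 1 \<in> \<real>\<^sub>\<ge>\<^sub>0"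
    using state_translate_square[OF x, of \<i>] by simp
  ultimately show ?thesis
    unfolding complex_nonneg_Reals_iff complex_eq_iff by simp
qed

lemma state_Cauchy_Schwarz:
  assumes x: "x \<in> B"
  shows "(cmod (\<phi> x))\<^sup>2 \<le> Re (\<phi> (star x * x))"
proof -
  have "\<phi> (star x * x) + - \<phi> x * \<phi> (star x) + cnj (- \<phi> x) * \<phi> x + cnj (- \<phi> x) * - \<phi> x
      = \<phi> (star x * x) - complex_of_real ((cmod (\<phi> x))\<^sup>2)"
    unfolding state_star[OF x] complex_norm_square by simp
  then show ?thesis using state_translate_square[OF x, of "- \<phi> x"]
    by (simp add: complex_nonneg_Reals_iff)
qed

text \<open>After normalising, \<open>1 - v\<close> with \<open>v = star x * x / (norm x)^2\<close>
  is itself of the form \<open>star y * y\<close>, where \<open>y\<close> is given by the binomial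
  series and lies in \<open>B\<close>. Positivity at \<open>y\<close> is the claim.\<close>

lemma state_square_le:
  assumes x: "x \<in> B"
  shows "Re (\<phi> (star x * x)) \<le> (norm x)\<^sup>2"
proof (cases "x = 0")
  case False
  define v where "v = (1 / (norm x)\<^sup>2) *\<^sub>R (star x * x)"
  have xx: "star x * x \<in> B" using B x by (auto intro: subalgebra_star subalgebra_mult)
  then have vB: "v \<in> B" unfolding v_def by (intro subalgebra_scaleR B)
  have v: "norm v \<le> 1" "star v = v"
    using False by (simp_all add: v_def cstar_identity star_scaleR star_mult)
  define y where "y = sqrt_one_minus v"
  have y: "y \<in> B" "star y * y = 1 - v"
    unfolding y_def using B vB v
    by (auto intro: sqrt_one_minus_in_subalgebra simp: star_sqrt_one_minus sqrt_one_minus_square)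
  have "0 \<le> Re (\<phi> (star y * y))" using state_nonneg[OF y(1)] by (simp add: complex_nonneg_Reals_iff)
  also have "\<phi> (star y * y) = 1 - complex_of_real (1 / (norm x)\<^sup>2) * \<phi> (star x * x)"
    unfolding y(2) using B vB by (simp add: state_diff state_one v_def state_scaleR[OF xx])
  finally show ?thesis using False by (simp add: field_simps)
qed (simp add: state_zero)

lemma norm_state_le:
  assumes x: "x \<in> B"
  shows "cmod (\<phi> x) \<le> norm x"
  by (rule power2_le_imp_le[OF order_trans[OF state_Cauchy_Schwarz[OF x] state_square_le[OF x]] norm_ge_zero])

lemma state_tendsto:
  assumes "\<And>n. X n \<in> B" "l \<in> B" "X \<longlonglongrightarrow> l"
  shows "(\<lambda>n. \<phi> (X n)) \<longlonglongrightarrow> \<phi> l"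
proof (rule LIM_zero_cancel, rule Lim_null_comparison)
  show "\<forall>\<^sub>F n in sequentially. norm (\<phi> (X n) - \<phi> l) \<le> norm (X n - l)"
    using assms by (simp add: state_diff[symmetric] norm_state_le subalgebra_diff[OF B(1)])
  show "(\<lambda>n. norm (X n - l)) \<longlonglongrightarrow> 0" using assms(3) by (intro tendsto_norm_zero LIM_zero)
qed

text \<open>States are contractive, hence continuous, so they pass through unconditional
  sums.\<close>

lemma state_has_sum:
  assumes f: "\<And>i. f i \<in> B" and x: "x \<in> B" and sum: "(f has_sum x) UNIV"
  shows "((\<lambda>i. \<phi> (f i)) has_sum \<phi> x) UNIV"
  unfolding has_sum_def
proof (rule LIM_zero_cancel, rule Lim_null_comparison)
  have "norm (\<phi> x - (\<Sum>i\<in>F. \<phi> (f i))) \<le> norm (x - sum f F)" for F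
    using f x by (simp add: state_sum[symmetric] state_diff[symmetric] norm_state_le
        subalgebra_diff[OF B(1)] subalgebra_sum[OF B(1)])
  then show "\<forall>\<^sub>F F in finite_subsets_at_top UNIV. norm ((\<Sum>i\<in>F. \<phi> (f i)) - \<phi> x) \<le> norm (sum f F - x)"
    by (simp add: norm_minus_commute)
  show "((\<lambda>F. norm (sum f F - x)) \<longlongrightarrow> 0) (finite_subsets_at_top UNIV)"
    using sum unfolding has_sum_def by (intro tendsto_norm_zero LIM_zero)
qed

end

section \<open>Quadratic forms and positivity of operators on a Hilbert space\<close>

lemmas bop_simps = times_bop.rep_eq plus_bop.rep_eq minus_bop.rep_eq uminus_bop.rep_eq one_bop.rep_eq
  zero_bop.rep_eq scaleC_bop.rep_eq

lemma scaleR_bop_apply: "bop_apply (r *\<^sub>R T) x = r *\<^sub>R bop_apply T x"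
  by (simp add: scaleR_scaleC scaleC_bop.rep_eq)

lemma bop_add: "bop_apply T (x + y) = bop_apply T x + bop_apply T y"
  and bop_scaleR: "bop_apply T (r *\<^sub>R x) = r *\<^sub>R bop_apply T x"
  and bop_zero [simp]: "bop_apply T 0 = 0"
  using bounded_linear.linear[OF bounded_linear_bop[of T]]
  by (rule linear_add linear_scale linear_0)+

lemma polarization:
  fixes x :: "'h::chilbert_space bop"
  defines "q \<equiv> \<lambda>\<zeta>. cinner (bop_apply x \<zeta>) \<zeta>"
  shows "4 * cinner (bop_apply x \<xi>) \<eta>
    = q (\<xi> + \<eta>) - q (\<xi> - \<eta>) + \<i> * (q (\<xi> + \<i> *\<^sub>C \<eta>) - q (\<xi> - \<i> *\<^sub>C \<eta>))"
proof -
  have q: "q (\<xi> + c *\<^sub>C \<eta>) = q \<xi> + cnj c * cinner (bop_apply x \<xi>) \<eta> + c * cinner (bop_apply x \<eta>) \<xi>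
      + c * cnj c * q \<eta>" for c
    unfolding q_def
    by (simp add: bop_add bop_scaleC cinner_add_left cinner_add_right cinner_scaleC_left
        cinner_scaleC_right distrib_left)
  have "(- \<i>) *\<^sub>C \<eta> = - (\<i> *\<^sub>C \<eta>)"
    using scaleC_scaleC[of "-1" \<i> \<eta>] unfolding scaleC_minus1 by simp
  then have eqs:
    "q (\<xi> + \<eta>) = q \<xi> + cinner (bop_apply x \<xi>) \<eta> + cinner (bop_apply x \<eta>) \<xi> + q \<eta>"
    "q (\<xi> - \<eta>) = q \<xi> - cinner (bop_apply x \<xi>) \<eta> - cinner (bop_apply x \<eta>) \<xi> + q \<eta>"
    "q (\<xi> + \<i> *\<^sub>C \<eta>) = q \<xi> - \<i> * cinner (bop_apply x \<xi>) \<eta> + \<i> * cinner (bop_apply x \<eta>) \<xi> + q \<eta>"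
    "q (\<xi> - \<i> *\<^sub>C \<eta>) = q \<xi> + \<i> * cinner (bop_apply x \<xi>) \<eta> - \<i> * cinner (bop_apply x \<eta>) \<xi> + q \<eta>"
    using q[of 1] q[of "-1"] q[of \<i>] q[of "- \<i>"] by simp_all
  show ?thesis unfolding eqs by (simp add: algebra_simps)
qed

text \<open>Polarization writes \<open>cinner (x \<xi>) \<eta>\<close> through four values of the
  quadratic form, and the parallelogram law adds up their bounds. The factor 2 is the classical one
  for arbitrary operators.\<close>

lemma norm_le_numerical_radius:
  fixes x :: "'h::chilbert_space bop"
  assumes w: "0 \<le> w" and le: "\<And>\<xi>. cmod (cinner (bop_apply x \<xi>) \<xi>) \<le> w * (norm \<xi>)\<^sup>2"
  shows "norm x \<le> 2 * w"
proof (rule norm_bop_bound)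
  fix \<xi> :: 'h
  have bound: "cmod (cinner (bop_apply x \<xi>) \<eta>) \<le> w * ((norm \<xi>)\<^sup>2 + (norm \<eta>)\<^sup>2)" for \<eta>
  proof -
    define q where "q \<zeta> = cinner (bop_apply x \<zeta>) \<zeta>" for \<zeta>
    have "4 * cmod (cinner (bop_apply x \<xi>) \<eta>) = cmod (4 * cinner (bop_apply x \<xi>) \<eta>)"
      by (simp add: norm_mult)
    also have "\<dots> \<le> (cmod (q (\<xi> + \<eta>)) + cmod (q (\<xi> - \<eta>)))
        + (cmod (q (\<xi> + \<i> *\<^sub>C \<eta>)) + cmod (q (\<xi> - \<i> *\<^sub>C \<eta>)))"
      unfolding polarization q_def[symmetric]
      by (intro order_trans[OF norm_triangle_ineq] add_mono norm_triangle_ineq4)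
        (simp add: norm_mult norm_triangle_ineq4)
    also have "\<dots> \<le> (w * (norm (\<xi> + \<eta>))\<^sup>2 + w * (norm (\<xi> - \<eta>))\<^sup>2)
        + (w * (norm (\<xi> + \<i> *\<^sub>C \<eta>))\<^sup>2 + w * (norm (\<xi> - \<i> *\<^sub>C \<eta>))\<^sup>2)"
      unfolding q_def by (intro add_mono le)
    also have "\<dots> = 4 * (w * ((norm \<xi>)\<^sup>2 + (norm \<eta>)\<^sup>2))"
      unfolding distrib_left[symmetric] parallelogram by (simp add: algebra_simps)
    finally show ?thesis by linarith
  qed
  show "norm (bop_apply x \<xi>) \<le> 2 * w * norm \<xi>"
  proof (cases "\<xi> = 0 \<or> bop_apply x \<xi> = 0")
    case False
    \<comment> \<open>Rescaling \<open>x \<xi>\<close> to the length of \<open>\<xi>\<close> makes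
      both terms of the bound equal.\<close>
    define \<eta> where "\<eta> = (norm \<xi> / norm (bop_apply x \<xi>)) *\<^sub>R bop_apply x \<xi>"
    have "cinner (bop_apply x \<xi>) \<eta> = complex_of_real (norm \<xi> * norm (bop_apply x \<xi>))"
      using False by (simp add: \<eta>_def scaleR_scaleC cinner_scaleC_right cinner_self power2_eq_square)
    moreover have "norm \<eta> = norm \<xi>" using False by (simp add: \<eta>_def)
    ultimately have "norm \<xi> * norm (bop_apply x \<xi>) \<le> norm \<xi> * (2 * w * norm \<xi>)"
      using bound[of \<eta>] by (simp add: norm_mult power2_eq_square algebra_simps)
    then show ?thesis using False by (simp add: mult_le_cancel_left)
  qed (use w in auto)
qed (use w in simp)

lemma bop_eq_zero_if_cinner_zero:
  fixes x :: "'h::chilbert_space bop"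
  assumes "\<And>\<xi>. cinner (bop_apply x \<xi>) \<xi> = 0"
  shows "x = 0"
  using norm_le_numerical_radius[of 0 x] assms by simp

definition positive_op :: "'h::chilbert_space bop \<Rightarrow> bool" where
  "positive_op x \<longleftrightarrow> (\<forall>\<xi>. cinner (bop_apply x \<xi>) \<xi> \<in> \<real>\<^sub>\<ge>\<^sub>0)"

text \<open>Over the complex numbers an operator is determined by its quadratic form, and a
  real-valued form agrees with that of the adjoint.\<close>

lemma positive_op_selfadjoint:
  assumes "positive_op x"
  shows "star x = x"
proof -
  have "cinner (bop_apply (star x - x) \<xi>) \<xi> = 0" for \<xi>
  proof -
    have "cinner (bop_apply (star x) \<xi>) \<xi> = cnj (cinner (bop_apply x \<xi>) \<xi>)"
      by (metis cinner_bop_right cinner_commute)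
    then show ?thesis using assms
      by (simp add: positive_op_def minus_bop_apply cinner_diff_left complex_nonneg_Reals_iff complex_eq_iff)
  qed
  then show ?thesis using bop_eq_zero_if_cinner_zero[of "star x - x"] by simp
qed

lemma positive_op_conjugate:
  assumes "positive_op x"
  shows "positive_op (star y * x * y)"
  using assms by (simp add: positive_op_def times_bop.rep_eq cinner_bop_left[of "star y"])

lemma positive_op_one: "positive_op 1"
  by (simp add: positive_op_def one_bop.rep_eq cinner_self)

lemma positive_op_star_mult: "positive_op (star y * y)"
  using positive_op_conjugate[OF positive_op_one, of y] by simp

lemma positive_op_add: "positive_op x \<Longrightarrow> positive_op y \<Longrightarrow> positive_op (x + y)"
  by (simp add: positive_op_def plus_bop.rep_eq cinner_add_left nonneg_Reals_add_I)

lemma positive_op_scaleR: "0 \<le> r \<Longrightarrow> positive_op x \<Longrightarrow> positive_op (r *\<^sub>R x)"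
  by (simp add: positive_op_def scaleR_scaleC scaleC_bop.rep_eq cinner_scaleC_left nonneg_Reals_mult_I)

lemma positive_op_antisym:
  assumes "positive_op x" "positive_op (- x)"
  shows "x = 0"
proof (rule bop_eq_zero_if_cinner_zero)
  fix \<xi>
  have "cinner (bop_apply x \<xi>) \<xi> \<in> \<real>\<^sub>\<ge>\<^sub>0" "- cinner (bop_apply x \<xi>) \<xi> \<in> \<real>\<^sub>\<ge>\<^sub>0"
    using assms by (simp_all add: positive_op_def uminus_bop.rep_eq cinner_minus_left)
  then show "cinner (bop_apply x \<xi>) \<xi> = 0" by (simp add: complex_nonneg_Reals_iff complex_eq_iff)
qed

lemma positive_op_one_minus:
  fixes x :: "'h::chilbert_space bop"
  assumes "norm x \<le> 1" "star x = x"
  shows "positive_op (1 - x)"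
  unfolding positive_op_def
proof
  fix \<xi> :: 'h
  have "Im (cinner (bop_apply x \<xi>) \<xi>) = 0"
    using cinner_commute[of "bop_apply x \<xi>" \<xi>] cinner_bop_right[of \<xi> x \<xi>] assms(2)
    by (simp add: complex_eq_iff)
  moreover have "Re (cinner (bop_apply x \<xi>) \<xi>) \<le> (norm \<xi>)\<^sup>2"
  proof -
    have "norm (bop_apply x \<xi>) \<le> 1 * norm \<xi>"
      using norm_bop[of x \<xi>] mult_right_mono[OF assms(1) norm_ge_zero[of \<xi>]] by linarith
    then have "norm (bop_apply x \<xi>) * norm \<xi> \<le> (norm \<xi>)\<^sup>2"
      by (simp add: power2_eq_square mult_right_mono)
    then show ?thesis using Re_cinner_le[of "bop_apply x \<xi>" \<xi>] by linarith
  qed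
  moreover have "cinner (bop_apply (1 - x) \<xi>) \<xi>
      = complex_of_real ((norm \<xi>)\<^sup>2) - cinner (bop_apply x \<xi>) \<xi>"
    by (simp only: minus_bop_apply one_bop.rep_eq cinner_diff_left cinner_self)
  ultimately show "cinner (bop_apply (1 - x) \<xi>) \<xi> \<in> \<real>\<^sub>\<ge>\<^sub>0"
    unfolding complex_nonneg_Reals_iff
    by (simp only: minus_complex.sel Re_complex_of_real Im_complex_of_real) simp
qed

section \<open>Representations\<close>

context
  fixes f :: "'a::cstar_algebra \<Rightarrow> 'b::cstar_algebra"
  assumes f: "star_hom f"
begin

lemma star_hom_add: "f (x + y) = f x + f y"
  and star_hom_scaleC: "f (c *\<^sub>C x) = c *\<^sub>C f x"
  and star_hom_mult: "f (x * y) = f x * f y"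
  and star_hom_star: "f (star x) = star (f x)"
  and star_hom_one: "f 1 = 1"
  using f by (auto simp: star_hom_def)

lemma star_hom_scaleR: "f (r *\<^sub>R x) = r *\<^sub>R f x"
  by (simp add: scaleR_scaleC star_hom_scaleC)

lemma star_hom_minus: "f (- x) = - f x"
  using star_hom_scaleC[of "-1" x] by simp

lemma star_hom_diff: "f (x - y) = f x - f y"
  using star_hom_add[of x "- y"] by (simp add: star_hom_minus)

lemma star_hom_zero: "f 0 = 0"
  using star_hom_diff[of 0 0] by simp

end

lemma star_hom_compose: "star_hom f \<Longrightarrow> star_hom g \<Longrightarrow> star_hom (\<lambda>x. f (g x))"
  by (simp add: star_hom_def)

text \<open>For a unit vector \<open>\<eta>\<close>, the map
  \<open>b \<mapsto> cinner (f b \<eta>) \<eta>\<close> is a state on the whole algebra, and its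
  value at \<open>star a * a\<close> is the squared length of \<open>f a \<eta>\<close>.\<close>

lemma star_hom_contractive:
  fixes f :: "'a::cstar_algebra \<Rightarrow> 'h::chilbert_space bop"
  assumes f: "star_hom f"
  shows "norm (f a) \<le> norm a"
proof (rule norm_bop_bound)
  fix \<xi> :: 'h
  have unit: "norm (bop_apply (f a) \<eta>) \<le> norm a" if \<eta>: "norm \<eta> = 1" for \<eta>
  proof -
    define \<phi> where "\<phi> b = cinner (bop_apply (f b) \<eta>) \<eta>" for b
    have \<phi>_square: "\<phi> (star b * b) = complex_of_real ((norm (bop_apply (f b) \<eta>))\<^sup>2)" for b
      by (simp add: \<phi>_def star_hom_mult[OF f] star_hom_star[OF f] times_bop.rep_eq
          cinner_bop_right[symmetric] cinner_bop_left cinner_self[symmetric] del: of_real_power)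
    then have "state_on UNIV \<phi>"
      unfolding state_on_def using \<eta> \<phi>_square
      by (auto simp: \<phi>_def star_hom_add[OF f] star_hom_scaleC[OF f] star_hom_one[OF f] bop_simps
          cinner_add_left cinner_scaleC_left cinner_self)
    then have "Re (\<phi> (star a * a)) \<le> (norm a)\<^sup>2"
      by (intro state_square_le[OF cstar_subalgebra_UNIV]) auto
    then show ?thesis
      unfolding \<phi>_square Re_complex_of_real by (rule power2_le_imp_le) simp
  qed
  show "norm (bop_apply (f a) \<xi>) \<le> norm a * norm \<xi>"
  proof (cases "\<xi> = 0")
    case False
    have "norm (bop_apply (f a) ((1 / norm \<xi>) *\<^sub>R \<xi>)) \<le> norm a"
      by (rule unit) (use False in simp)
    then show ?thesis using False by (simp add: bop_scaleR pos_divide_le_eq)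
  qed simp
qed simp

section \<open>Injective representations reflect positivity and are isometric\<close>

context
  fixes f :: "'a::cstar_algebra \<Rightarrow> 'h::chilbert_space bop"
  assumes f: "star_hom f" and inj: "inj f"
begin

text \<open>The positive part \<open>p\<close> of \<open>k\<close> satisfies \<open>p\<^sup>3 = 2 p k p = 2 p \<bar>k\<bar> p\<close>, so its image is both
  nonnegative and nonpositive.\<close>

lemma sqrt_of_nonpos:
  assumes k: "star k = k" "norm k \<le> 1" and neg: "positive_op (- f k)"
  shows "\<exists>z. star z = z \<and> z * z = - k \<and> (\<forall>x. x * k = k * x \<longrightarrow> x * z = z * x)"
proof -
  \<comment> \<open>Chosen so that \<open>1 - w = k * k\<close>; the root \<open>m\<close> is then
    the absolute value of \<open>k\<close>, and \<open>p\<close> below is twice its positive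
    part.\<close>
  define w where "w = 1 - k * k"
  have w: "norm w \<le> 1" "star w = w"
    unfolding w_def using k by (simp_all add: norm_one_minus_square_le star_diff star_mult)
  define m where "m = sqrt_one_minus w"
  have m: "star m = m" "m * m = k * k" "norm (1 - m) \<le> 1"
    unfolding m_def star_sqrt_one_minus[OF w] sqrt_one_minus_square[OF w(1)]
    using norm_one_diff_sqrt_one_minus[OF w(1)] by (simp_all add: w_def)
  have m_comm: "x * m = m * x" if "x * k = k * x" for x
    unfolding m_def
  proof (rule sqrt_one_minus_commute[OF w(1)])
    have "x * (k * k) = (k * k) * x" using that by (metis mult.assoc)
    then show "x * w = w * x" by (simp add: w_def algebra_simps)
  qed
  define p where "p = k + m"
  have sp: "star p = p" by (simp add: p_def star_add k m)
  have "m * p = k * p" by (simp add: p_def distrib_left m m_comm)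
  moreover have "p * p = k * p + m * p" by (simp add: p_def distrib_right)
  ultimately have pp: "p * p = 2 *\<^sub>R (k * p)" "p * p = 2 *\<^sub>R (m * p)" by (simp_all add: scaleR_2)
  have ppp: "p * p * p = 2 *\<^sub>R (star p * k * p)" "p * p * p = 2 *\<^sub>R (star p * m * p)"
    unfolding sp mult.assoc[of p] using pp by (metis mult_scaleR_right)+
  have "positive_op (f m)"
  proof -
    have "positive_op (1 - f (1 - m))"
      by (rule positive_op_one_minus)
        (use star_hom_contractive[OF f, of "1 - m"] m in \<open>simp_all add: star_hom_star[OF f, symmetric] star_diff\<close>)
    then show ?thesis by (simp add: star_hom_diff[OF f] star_hom_one[OF f])
  qed
  then have pos1: "positive_op (f (p * p * p))"
    unfolding ppp(2)
    by (simp add: star_hom_mult[OF f] star_hom_scaleR[OF f] star_hom_star[OF f] positive_op_conjugate positive_op_scaleR)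
  have "positive_op (2 *\<^sub>R (star (f p) * (- f k) * f p))"
    using neg by (intro positive_op_scaleR positive_op_conjugate) auto
  then have "positive_op (- f (p * p * p))"
    unfolding ppp(1) by (simp add: star_hom_mult[OF f] star_hom_scaleR[OF f] star_hom_star[OF f])
  with pos1 have "f (p * p * p) = 0" by (rule positive_op_antisym)
  then have ppp0: "p * p * p = 0"
    using injD[OF inj, of "p * p * p" 0] by (simp add: star_hom_zero[OF f])
  \<comment> \<open>For selfadjoint elements the norm of a square is the square of the norm, so a
    vanishing fourth power forces \<open>p = 0\<close>.\<close>
  have "(p * p) * (p * p) = (p * p * p) * p" by (simp only: mult.assoc)
  then have "norm ((p * p) * (p * p)) = 0" by (simp add: ppp0)
  then have "p = 0"
    using norm_square_selfadjoint[of "p * p"] norm_square_selfadjoint[of p] sp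
    by (simp add: star_mult del: mult_eq_0_iff)
  then have mk: "m = - k" by (simp add: p_def eq_neg_iff_add_eq_0 add.commute)
  \<comment> \<open>Since \<open>m = - k\<close>, this is the square root of
    \<open>1 - (1 - m) = - k\<close>.\<close>
  define z where "z = sqrt_one_minus (1 - m)"
  have "star z = z" "z * z = - k"
    unfolding z_def using m by (simp_all add: star_sqrt_one_minus sqrt_one_minus_square star_diff) (simp add: mk)
  moreover have "x * z = z * x" if "x * k = k * x" for x
    unfolding z_def by (rule sqrt_one_minus_commute[OF m(3)]) (simp add: algebra_simps m_comm[OF that])
  ultimately show ?thesis by blast
qed

text \<open>Scaling into the unit ball and changing the sign reduces this to
  \<open>sqrt_of_nonpos\<close>; the root is scaled back by \<open>sqrt c\<close>.\<close>

lemma sqrt_of_positive: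
  assumes "positive_op (f a)"
  shows "\<exists>z. star z = z \<and> z * z = a \<and> (\<forall>x. x * a = a * x \<longrightarrow> x * z = z * x)"
proof -
  have sa: "star a = a"
    using positive_op_selfadjoint[OF assms] injD[OF inj] by (metis star_hom_star[OF f])
  \<comment> \<open>The summand 1 keeps the divisor positive when \<open>a = 0\<close>.\<close>
  define c where "c = norm a + 1"
  have c: "0 < c" by (simp add: c_def add_nonneg_pos)
  define k where "k = (- (1 / c)) *\<^sub>R a"
  have k: "star k = k" "norm k \<le> 1"
    using c sa by (auto simp: k_def star_scaleR divide_simps star_minus) (simp add: c_def)
  have "- f k = (1 / c) *\<^sub>R f a" by (simp add: k_def star_hom_scaleR[OF f] star_hom_minus[OF f])
  then have "positive_op (- f k)" using assms c by (simp add: positive_op_scaleR)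
  from sqrt_of_nonpos[OF k this] obtain z where
    z: "star z = z" "z * z = - k" "\<And>x. x * k = k * x \<Longrightarrow> x * z = z * x" by blast
  have "(sqrt c *\<^sub>R z) * (sqrt c *\<^sub>R z) = a" using c z(2) by (simp add: k_def)
  moreover have "x * (sqrt c *\<^sub>R z) = (sqrt c *\<^sub>R z) * x" if "x * a = a * x" for x
    using z(3)[of x] that by (simp add: k_def)
  ultimately show ?thesis using z(1) by (metis star_scaleR)
qed

text \<open>If \<open>h\<close> is selfadjoint and \<open>f h\<close> is a contraction, then
  \<open>f (1 - h * h)\<close> is positive, so \<open>1 - h * h\<close> has a selfadjoint square
  root commuting with \<open>h\<close>, which forces \<open>norm h \<le> 1\<close>. Scaling and the
  \<open>C*\<close>-identity give the general case.\<close>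

lemma injective_star_hom_isometric: "norm (f a) = norm a"
proof -
  have unit: "norm h \<le> 1" if h: "star h = h" "norm (f h) \<le> 1" for h
  proof -
    have sa: "star (f h) = f h" using h by (simp add: star_hom_star[OF f, symmetric])
    have "positive_op (1 - f h * f h)"
      by (rule positive_op_one_minus)
        (use h(2) sa in \<open>simp_all add: norm_square_selfadjoint power_le_one star_mult\<close>)
    then have "positive_op (f (1 - h * h))"
      by (simp add: star_hom_diff[OF f] star_hom_mult[OF f] star_hom_one[OF f])
    from sqrt_of_positive[OF this] obtain z where
      z: "star z = z" "z * z = 1 - h * h" "\<And>x. x * (1 - h * h) = (1 - h * h) * x \<Longrightarrow> x * z = z * x"
      by blast
    have "h * z = z * h" by (rule z(3)) (simp add: algebra_simps)
    then show ?thesis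
      using norm_le_one_if_square_sum_one(1)[OF h(1) z(1)] z(2) by simp
  qed
  have selfadjoint: "norm h \<le> norm (f h)" if h: "star h = h" for h
  proof (cases "f h = 0")
    case True
    then have "h = 0" using injD[OF inj, of h 0] by (simp add: star_hom_zero[OF f])
    then show ?thesis by simp
  next
    case False
    have "norm ((1 / norm (f h)) *\<^sub>R h) \<le> 1"
      using h False by (intro unit) (simp_all add: star_scaleR star_hom_scaleR[OF f])
    then show ?thesis using False by (simp add: field_simps)
  qed
  have "(norm a)\<^sup>2 \<le> (norm (f a))\<^sup>2"
    using selfadjoint[of "star a * a"]
    by (simp add: star_mult star_hom_mult[OF f] star_hom_star[OF f] cstar_identity)
  then have "norm a \<le> norm (f a)" by (simp add: power2_le_iff_abs_le)
  then show ?thesis using star_hom_contractive[OF f, of a] by linarith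
qed

lemma closed_range_injective_star_hom: "closed (range f)"
proof -
  have lin: "bounded_linear f"
    using star_hom_contractive[OF f]
    by (intro bounded_linear_intro[where K = 1]) (simp_all add: star_hom_add[OF f] star_hom_scaleR[OF f])
  have "complete (range f)"
    by (rule complete_isometric_image[of 1 UNIV f])
      (simp_all add: lin injective_star_hom_isometric subspace_UNIV complete_UNIV)
  then show ?thesis by (rule complete_imp_closed)
qed

end

section \<open>Operators on \<open>\<ell>\<^sup>2(\<Gamma>, H)\<close>\<close>

lemmas ell2_simps = plus_ell2.rep_eq minus_ell2.rep_eq uminus_ell2.rep_eq zero_ell2.rep_eq scaleC_ell2.rep_eq

lemma norm_ell2_apply_le: "norm (ell2_apply \<xi> t) \<le> norm \<xi>"
  using norm_le_l2norm[OF square_summable_ell2] by (simp add: norm_ell2.rep_eq)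

lemma cinner_delta: "cinner \<xi> (delta t v) = cinner (ell2_apply \<xi> t) v"
proof -
  have "cinner \<xi> (delta t v) = (\<Sum>\<^sub>\<infinity>u\<in>UNIV. cinner (ell2_apply \<xi> u) (if u = t then v else 0))"
    by (simp add: cinner_ell2.rep_eq delta.rep_eq)
  also have "\<dots> = (\<Sum>\<^sub>\<infinity>u\<in>{t}. cinner (ell2_apply \<xi> u) v)"
    by (rule infsum_cong_neutral) auto
  finally show ?thesis by simp
qed

lemma norm_delta [simp]: "norm (delta t v) = norm v"
proof -
  have "complex_of_real ((norm (delta t v))\<^sup>2) = complex_of_real ((norm v)\<^sup>2)"
    unfolding cinner_self[symmetric] cinner_delta by (simp add: delta.rep_eq)
  then show ?thesis by (simp only: of_real_eq_iff power2_eq_iff_nonneg norm_ge_zero)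
qed

lemma delta_add: "delta t (v + w) = delta t v + delta t w"
  by (rule ell2_eqI) (simp add: ell2_simps delta.rep_eq)

lemma delta_scaleC: "delta t (c *\<^sub>C v) = c *\<^sub>C delta t v"
  by (rule ell2_eqI) (simp add: ell2_simps delta.rep_eq)

section \<open>Left translations form a unitary representation\<close>

lemma left_translation_add: "left_translation (s + t) = left_translation s * left_translation t"
  by (intro bop_eqI ell2_eqI)
    (simp add: times_bop.rep_eq left_translation_apply minus_add add.assoc
      del: add_uminus_conv_diff)

lemma left_translation_zero [simp]: "left_translation 0 = 1"
  by (intro bop_eqI ell2_eqI) (simp add: one_bop.rep_eq left_translation_apply)

lemma star_left_translation [simp]:
  fixes s :: "'g::group_add"
  shows "star (left_translation s :: ('g, 'h::chilbert_space) ell2 bop) = left_translation (- s)"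
proof (rule adjoint_unique)
  fix \<xi> \<eta> :: "('g, 'h) ell2"
  have "cinner \<xi> (bop_apply (star (left_translation s)) \<eta>) = cinner (bop_apply (left_translation s) \<xi>) \<eta>"
    by (rule cinner_bop_left[symmetric])
  also have "\<dots> = (\<Sum>\<^sub>\<infinity>t. cinner (ell2_apply \<xi> (- s + t)) (ell2_apply \<eta> t))"
    by (simp add: cinner_ell2.rep_eq left_translation_apply)
  also have "\<dots> = (\<Sum>\<^sub>\<infinity>t. cinner (ell2_apply \<xi> (- s + (s + t))) (ell2_apply \<eta> (s + t)))"
    by (rule infsum_reindex_bij_betw[OF bij_plus, symmetric])
  also have "\<dots> = cinner \<xi> (bop_apply (left_translation (- s)) \<eta>)"
    by (simp add: cinner_ell2.rep_eq left_translation_apply add.assoc[symmetric])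
  finally show "cinner \<xi> (bop_apply (star (left_translation s)) \<eta>)
      = cinner \<xi> (bop_apply (left_translation (- s)) \<eta>)" .
qed

lemma inner_action_eq: "inner_action s x = left_translation s * x * left_translation (- s)"
  by (simp add: inner_action_def)

lemma left_translation_cancel [simp]:
  "left_translation s * left_translation (- s) = 1" "left_translation (- s) * left_translation s = 1"
  by (simp_all flip: left_translation_add)

section \<open>Block-diagonal operators and compression to the block diagonal\<close>

definition diag :: "('g \<Rightarrow> 'h::chilbert_space bop) \<Rightarrow> ('g::group_add, 'h) ell2 bop" where
  "diag d = Bop (\<lambda>\<xi>. Ell2 (\<lambda>t. d t (ell2_apply \<xi> t)))"

lemma crossed_embedding_eq_diag: "crossed_embedding \<alpha> \<pi> a = diag (\<lambda>t. \<pi> (\<alpha> (- t) a))"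
  by (simp add: crossed_embedding_def diag_def)

lemma diag_apply:
  assumes "\<And>t. norm (d t) \<le> K"
  shows "ell2_apply (bop_apply (diag d) \<xi>) t = bop_apply (d t) (ell2_apply \<xi> t)"
proof -
  \<comment> \<open>A bounded family is read as an embedding whose action is
    \<open>s \<mapsto> d (- s)\<close> and whose representation is \<open>id\<close>, so that
    \<open>crossed_embedding_apply\<close> covers it.\<close>
  have "diag d = crossed_embedding (\<lambda>s _. d (- s)) id (0 :: 'b bop)"
    by (simp add: crossed_embedding_eq_diag)
  then show ?thesis
    using crossed_embedding_apply[of id "\<lambda>s _. d (- s)" 0 K \<xi> t] assms by simp
qed

lemma norm_diag_le:
  assumes K: "0 \<le> K" "\<And>t. norm (d t) \<le> K"
  shows "norm (diag d) \<le> K"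
proof (rule norm_bop_bound[OF K(1)])
  fix \<xi>
  have "ell2_apply (bop_apply (diag d) \<xi>) = (\<lambda>t. bop_apply (d t) (ell2_apply \<xi> t))"
    by (rule ext) (rule diag_apply[OF K(2)])
  then show "norm (bop_apply (diag d) \<xi>) \<le> K * norm \<xi>"
    using square_summable_diagonal(2)[OF K(2) square_summable_ell2, of "\<lambda>t. t" \<xi>]
    by (simp add: norm_ell2.rep_eq)
qed

text \<open>The matrix entry of \<open>x\<close> at position \<open>(t, t)\<close> when
  \<open>x\<close> is viewed as a matrix of operators on the fibres.\<close>

definition block :: "('g, 'h::chilbert_space) ell2 bop \<Rightarrow> 'g \<Rightarrow> 'h bop" where
  "block x t = Bop (\<lambda>v. ell2_apply (x (delta t v)) t)"

lemma block_apply: "bop_apply (block x t) v = ell2_apply (bop_apply x (delta t v)) t"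
proof -
  define L where "L v = ell2_apply (bop_apply x (delta t v)) t" for v
  have LC: "L (c *\<^sub>C v) = c *\<^sub>C L v" for c v
    by (simp add: L_def delta_scaleC bop_scaleC ell2_simps)
  have "norm (L v) \<le> norm v * norm x" for v
    using norm_ell2_apply_le[of "bop_apply x (delta t v)" t] norm_bop[of x "delta t v"]
    by (simp add: L_def mult.commute)
  moreover have "L (v + w) = L v + L w" for v w
    by (simp add: L_def delta_add bop_add ell2_simps)
  ultimately have "bounded_linear L"
    by (intro bounded_linear_intro[where K = "norm x"]) (auto simp: scaleR_scaleC LC)
  then have "bop_apply (Bop L) = L" by (simp add: Bop_inverse LC)
  then show ?thesis by (simp add: block_def L_def[abs_def])
qed

lemma norm_block_le: "norm (block x t) \<le> norm x"
proof (rule norm_bop_bound)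
  show "norm (bop_apply (block x t) v) \<le> norm x * norm v" for v
    using norm_ell2_apply_le[of "bop_apply x (delta t v)" t] norm_bop[of x "delta t v"]
    by (simp add: block_apply)
qed simp

definition diagonal :: "('g::group_add, 'h::chilbert_space) ell2 bop \<Rightarrow> ('g, 'h) ell2 bop" where
  "diagonal x = diag (block x)"

lemma diagonal_apply:
  "ell2_apply (bop_apply (diagonal x) \<xi>) t = ell2_apply (bop_apply x (delta t (ell2_apply \<xi> t))) t"
  unfolding diagonal_def by (simp add: diag_apply[OF norm_block_le] block_apply)

lemma norm_diagonal_le: "norm (diagonal x) \<le> norm x"
  unfolding diagonal_def by (rule norm_diag_le) (simp_all add: norm_block_le)

lemma diagonal_add: "diagonal (x + y) = diagonal x + diagonal y"
  by (intro bop_eqI ell2_eqI) (simp add: diagonal_apply bop_simps ell2_simps)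

lemma diagonal_scaleC: "diagonal (c *\<^sub>C x) = c *\<^sub>C diagonal x"
  by (intro bop_eqI ell2_eqI) (simp add: diagonal_apply bop_simps ell2_simps)

lemma diagonal_diff: "diagonal (x - y) = diagonal x - diagonal y"
  by (intro bop_eqI ell2_eqI) (simp add: diagonal_apply bop_simps ell2_simps)

lemma diag_delta:
  assumes "\<And>t. norm (d t) \<le> K"
  shows "bop_apply (diag d) (delta t v) = delta t (bop_apply (d t) v)"
  by (rule ell2_eqI) (simp add: diag_apply[OF assms] delta.rep_eq)

text \<open>Diagonal operators map each summand \<open>delta t\<close> to itself, so they only
  multiply the entry at \<open>(t, t)\<close>.\<close>

lemma diagonal_bimodule:
  assumes d: "\<And>t. norm (d t) \<le> K" and e: "\<And>t. norm (e t) \<le> L"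
  shows "diagonal (diag d * x * diag e) = diag d * diagonal x * diag e"
  by (intro bop_eqI ell2_eqI)
    (simp add: diagonal_apply times_bop.rep_eq diag_delta[OF e] diag_apply[OF d] diag_apply[OF e])

lemma diagonal_diag:
  assumes d: "\<And>t. norm (d t) \<le> K"
  shows "diagonal (diag d) = diag d"
  by (intro bop_eqI ell2_eqI) (simp add: diagonal_apply diag_apply[OF d] delta.rep_eq)

text \<open>Translation by \<open>s \<noteq> 0\<close> moves every fibre to a different one, so all
  diagonal entries vanish.\<close>

lemma diagonal_diag_left_translation:
  assumes d: "\<And>t. norm (d t) \<le> K" and s: "s \<noteq> 0"
  shows "diagonal (diag d * left_translation s) = 0"
proof (intro bop_eqI ell2_eqI)
  fix \<xi> and t :: 'a
  have "- s + t \<noteq> t" using s add_right_cancel[of "- s" t 0] by simp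
  then show "ell2_apply (bop_apply (diagonal (diag d * left_translation s)) \<xi>) t = ell2_apply (bop_apply 0 \<xi>) t"
    by (simp add: diagonal_apply times_bop.rep_eq diag_apply[OF d] left_translation_apply delta.rep_eq bop_simps ell2_simps)
qed

text \<open>Summability is not assumed: a divergent \<open>infsum\<close> has the default value 0,
  which is nonnegative.\<close>

lemma infsum_nonneg_Reals:
  fixes f :: "'i \<Rightarrow> complex"
  assumes "\<And>i. f i \<in> \<real>\<^sub>\<ge>\<^sub>0"
  shows "infsum f UNIV \<in> \<real>\<^sub>\<ge>\<^sub>0"
proof (cases "f summable_on UNIV")
  case True
  then have "0 \<le> infsum f UNIV"
    using assms by (intro infsum_nonneg_complex) (simp_all add: less_eq_complex_def complex_nonneg_Reals_iff)
  then show ?thesis by (simp add: less_eq_complex_def complex_nonneg_Reals_iff)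
qed (simp add: infsum_not_exists)

text \<open>The form of \<open>diagonal x\<close> at \<open>\<xi>\<close> is the sum over
  \<open>t\<close> of the form of \<open>x\<close> at \<open>delta t (\<xi> t)\<close>.\<close>

lemma positive_op_diagonal:
  assumes "positive_op x"
  shows "positive_op (diagonal x)"
  unfolding positive_op_def
proof
  fix \<xi>
  have "cinner (ell2_apply (bop_apply (diagonal x) \<xi>) t) (ell2_apply \<xi> t) \<in> \<real>\<^sub>\<ge>\<^sub>0" for t
    using assms unfolding positive_op_def diagonal_apply cinner_delta[symmetric] by blast
  then show "cinner (bop_apply (diagonal x) \<xi>) \<xi> \<in> \<real>\<^sub>\<ge>\<^sub>0"
    unfolding cinner_ell2.rep_eq by (rule infsum_nonneg_Reals)
qed

section \<open>The reduced crossed product and its canonical expectation\<close>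

lemma cstar_subalgebra_closure:
  fixes M :: "'a::cstar_algebra set"
  assumes M: "0 \<in> M" "\<And>x y. x \<in> M \<Longrightarrow> y \<in> M \<Longrightarrow> x + y \<in> M" "\<And>c x. x \<in> M \<Longrightarrow> c *\<^sub>C x \<in> M"
    "\<And>x y. x \<in> M \<Longrightarrow> y \<in> M \<Longrightarrow> x * y \<in> M" "\<And>x. x \<in> M \<Longrightarrow> star x \<in> M"
  shows "cstar_subalgebra (closure M)"
proof -
  have "x + y \<in> closure M" "x * y \<in> closure M" if xy: "x \<in> closure M" "y \<in> closure M" for x y
  proof -
    obtain X Y where X: "\<And>n. X n \<in> M" "X \<longlonglongrightarrow> x" and Y: "\<And>n. Y n \<in> M" "Y \<longlonglongrightarrow> y"
      using xy unfolding closure_sequential by blast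
    have "(\<lambda>n. X n + Y n) \<longlonglongrightarrow> x + y" "(\<lambda>n. X n * Y n) \<longlonglongrightarrow> x * y"
      using X Y by (auto intro: tendsto_intros)
    moreover have "X n + Y n \<in> M" "X n * Y n \<in> M" for n using X(1) Y(1) M(2,4) by simp_all
    ultimately show "x + y \<in> closure M" "x * y \<in> closure M"
      unfolding closure_sequential by meson+
  qed
  moreover have "c *\<^sub>C x \<in> closure M" "star x \<in> closure M" if x: "x \<in> closure M" for x c
  proof -
    obtain X where X: "\<And>n. X n \<in> M" "X \<longlonglongrightarrow> x"
      using x unfolding closure_sequential by blast
    have "(\<lambda>n. c *\<^sub>C X n) \<longlonglongrightarrow> c *\<^sub>C x" "(\<lambda>n. star (X n)) \<longlonglongrightarrow> star x"
      by (rule bounded_linear.tendsto[OF bounded_linear_scaleC X(2)],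
          rule bounded_linear.tendsto[OF bounded_linear_star X(2)])
    moreover have "c *\<^sub>C X n \<in> M" "star (X n) \<in> M" for n using X(1) M(3,5) by simp_all
    ultimately show "c *\<^sub>C x \<in> closure M" "star x \<in> closure M"
      unfolding closure_sequential by meson+
  qed
  ultimately show ?thesis
    unfolding cstar_subalgebra_def using subsetD[OF closure_subset M(1)] by auto
qed

lemma cstar_subalgebra_generated: "cstar_subalgebra (cstar_generated S)"
  unfolding cstar_generated_def
  by (rule hull_in) (auto simp: cstar_subalgebra_def intro!: closed_Inter)

lemma generators_subset: "S \<subseteq> cstar_generated S"
  by (simp add: cstar_generated_def hull_subset)

section \<open>The embedding, its covariance, and a dense star-subalgebra\<close>

locale crossed_system =
  fixes \<alpha> :: "'g::group_add \<Rightarrow> 'a::cstar_algebra \<Rightarrow> 'a" and \<pi> :: "'a \<Rightarrow> 'h::chilbert_space bop"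
  assumes action: "action \<alpha>" and faithful: "faithful_representation \<pi>"
begin

abbreviation "\<sigma> \<equiv> crossed_embedding \<alpha> \<pi>"

abbreviation "translation \<equiv> (left_translation :: 'g \<Rightarrow> ('g, 'h) ell2 bop)"

lemma star_hom_action: "star_hom (\<alpha> s)"
  and action_zero: "\<alpha> 0 a = a"
  and action_add: "\<alpha> (s + t) a = \<alpha> s (\<alpha> t a)"
  using action by (auto simp: action_def)

lemma star_hom_rep: "star_hom \<pi>" and inj_rep: "inj \<pi>"
  using faithful by (auto simp: faithful_representation_def)

lemma star_hom_rep_action: "star_hom (\<lambda>a. \<pi> (\<alpha> s a))"
  by (rule star_hom_compose[OF star_hom_rep star_hom_action])

lemma norm_rep_action_le: "norm (\<pi> (\<alpha> s a)) \<le> norm a"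
  by (rule star_hom_contractive[OF star_hom_rep_action])

lemma embedding_apply:
  "ell2_apply (bop_apply (\<sigma> a) \<xi>) t = bop_apply (\<pi> (\<alpha> (- t) a)) (ell2_apply \<xi> t)"
  by (rule crossed_embedding_apply[where K = "norm a"]) (rule norm_rep_action_le)

lemma star_hom_embedding: "star_hom \<sigma>"
proof -
  note [simp] = star_hom_add[OF star_hom_rep_action] star_hom_scaleC[OF star_hom_rep_action]
    star_hom_mult[OF star_hom_rep_action] star_hom_one[OF star_hom_rep_action]
    star_hom_star[OF star_hom_rep_action] embedding_apply bop_simps ell2_simps
  have "\<sigma> (star a) = star (\<sigma> a)" for a
  proof (rule adjoint_unique)
    fix \<xi> \<eta>
    have "cinner \<xi> (bop_apply (\<sigma> (star a)) \<eta>) = cinner (bop_apply (\<sigma> a) \<xi>) \<eta>"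
      by (simp add: cinner_ell2.rep_eq cinner_bop_left)
    then show "cinner \<xi> (bop_apply (\<sigma> (star a)) \<eta>) = cinner \<xi> (bop_apply (star (\<sigma> a)) \<eta>)"
      by (simp only: cinner_bop_left)
  qed
  moreover have "\<sigma> (a + b) = \<sigma> a + \<sigma> b" "\<sigma> (c *\<^sub>C a) = c *\<^sub>C \<sigma> a" "\<sigma> (a * b) = \<sigma> a * \<sigma> b" "\<sigma> 1 = 1" for a b c
    by (intro bop_eqI ell2_eqI; simp)+
  ultimately show ?thesis by (simp add: star_hom_def)
qed

text \<open>In the fibre over the neutral element, \<open>\<sigma> a\<close> acts as
  \<open>\<pi> a\<close>.\<close>

lemma inj_embedding: "inj \<sigma>"
proof (rule injI)
  fix a b assume eq: "\<sigma> a = \<sigma> b"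
  have "\<pi> a = \<pi> b"
  proof (rule bop_eqI)
    fix v
    have "ell2_apply (bop_apply (\<sigma> a) (delta 0 v)) 0 = ell2_apply (bop_apply (\<sigma> b) (delta 0 v)) 0"
      using eq by simp
    then show "bop_apply (\<pi> a) v = bop_apply (\<pi> b) v"
      by (simp add: embedding_apply delta.rep_eq action_zero)
  qed
  then show "a = b" using injD[OF inj_rep] by blast
qed

lemma embedding_covariant: "translation s * \<sigma> a = \<sigma> (\<alpha> s a) * translation s"
  by (intro bop_eqI ell2_eqI)
    (simp add: times_bop.rep_eq left_translation_apply embedding_apply minus_add action_add[symmetric])

lemma inner_action_embedding: "inner_action s (\<sigma> a) = \<sigma> (\<alpha> s a)"
  by (simp add: inner_action_eq embedding_covariant mult.assoc)

text \<open>The algebraic crossed product. Scalars are absorbed into the coefficient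
  \<open>a\<close>, so sums of monomials already form a star-algebra.\<close>

inductive_set crossed_sums :: "('g, 'h) ell2 bop set" where
  monomial: "\<sigma> a * translation s \<in> crossed_sums"
| add: "x \<in> crossed_sums \<Longrightarrow> y \<in> crossed_sums \<Longrightarrow> x + y \<in> crossed_sums"

lemma crossed_sums_zero: "0 \<in> crossed_sums"
  using crossed_sums.monomial[of 0 0] by (simp add: star_hom_zero[OF star_hom_embedding])

lemma crossed_sums_scaleC: "x \<in> crossed_sums \<Longrightarrow> c *\<^sub>C x \<in> crossed_sums"
proof (induction rule: crossed_sums.induct)
  case (monomial a s)
  show ?case using crossed_sums.monomial[of "c *\<^sub>C a" s]
    by (simp add: star_hom_scaleC[OF star_hom_embedding] mult_scaleC_left)
qed (simp add: scaleC_add_right crossed_sums.add)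

lemma crossed_sums_star: "x \<in> crossed_sums \<Longrightarrow> star x \<in> crossed_sums"
proof (induction rule: crossed_sums.induct)
  case (monomial a s)
  have "star (\<sigma> a * translation s) = \<sigma> (\<alpha> (- s) (star a)) * translation (- s)"
    by (simp add: star_mult star_hom_star[OF star_hom_embedding, symmetric] embedding_covariant)
  then show ?case by (simp add: crossed_sums.monomial)
qed (simp add: star_add crossed_sums.add)

lemma monomial_mult:
  "(\<sigma> a * translation s) * (\<sigma> b * translation t) = \<sigma> (a * \<alpha> s b) * translation (s + t)"
proof -
  have "(\<sigma> a * translation s) * (\<sigma> b * translation t) = \<sigma> a * (translation s * \<sigma> b) * translation t"
    by (simp only: mult.assoc)
  then show ?thesis
    by (simp add: embedding_covariant star_hom_mult[OF star_hom_embedding] left_translation_add mult.assoc)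
qed

lemma crossed_sums_mult: "x \<in> crossed_sums \<Longrightarrow> y \<in> crossed_sums \<Longrightarrow> x * y \<in> crossed_sums"
proof (induction rule: crossed_sums.induct)
  case (monomial a s)
  from monomial.prems show ?case
  proof (induction rule: crossed_sums.induct)
    case (monomial b t)
    show ?case unfolding monomial_mult by (rule crossed_sums.monomial)
  qed (simp add: distrib_left crossed_sums.add)
qed (simp add: distrib_right crossed_sums.add)

abbreviation "B \<equiv> crossed_product \<alpha> \<pi>"

lemma subalgebra_crossed_product: "cstar_subalgebra B"
  unfolding crossed_product_def by (rule cstar_subalgebra_generated)

lemma translation_in_crossed_product: "translation s \<in> B"
  and embedding_in_crossed_product: "\<sigma> a \<in> B"
  unfolding crossed_product_def by (rule subsetD[OF generators_subset], blast)+

lemma one_in_crossed_product: "1 \<in> B"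
  using translation_in_crossed_product[of 0] by simp

lemma crossed_sums_subset: "crossed_sums \<subseteq> B"
proof
  note sub = subalgebra_crossed_product
  show "x \<in> crossed_sums \<Longrightarrow> x \<in> B" for x
  proof (induction rule: crossed_sums.induct)
    case (monomial a s)
    show ?case by (rule subalgebra_mult[OF sub embedding_in_crossed_product translation_in_crossed_product])
  next
    case (add x y)
    then show ?case by (intro subalgebra_add[OF sub])
  qed
qed

lemma crossed_product_eq_closure: "B = closure crossed_sums"
proof
  show "closure crossed_sums \<subseteq> B"
    using crossed_sums_subset subalgebra_closed[OF subalgebra_crossed_product] by (rule closure_minimal)
  have "translation s \<in> crossed_sums" "\<sigma> a \<in> crossed_sums" for a s
    using crossed_sums.monomial[of 1 s] crossed_sums.monomial[of a 0]
    by (simp_all add: star_hom_one[OF star_hom_embedding])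
  then have "range translation \<union> range \<sigma> \<subseteq> closure crossed_sums"
    using closure_subset by blast
  moreover have "cstar_subalgebra (closure crossed_sums)"
    by (intro cstar_subalgebra_closure crossed_sums_zero crossed_sums_scaleC crossed_sums_star
        crossed_sums_mult crossed_sums.add)
  ultimately show "B \<subseteq> closure crossed_sums"
    unfolding crossed_product_def cstar_generated_def by (rule hull_minimal)
qed

text \<open>Density of \<open>crossed_sums\<close> reduces statements that are additive and stable
  under norm limits to monomials.\<close>

lemma crossed_product_induct [consumes 1, case_names monomial add limit]:
  assumes x: "x \<in> B"
    and mono: "\<And>a s. P (\<sigma> a * translation s)"
    and add: "\<And>y z. y \<in> B \<Longrightarrow> z \<in> B \<Longrightarrow> P y \<Longrightarrow> P z \<Longrightarrow> P (y + z)"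
    and lim: "\<And>X l. (\<And>n. X n \<in> B) \<Longrightarrow> (\<And>n. P (X n)) \<Longrightarrow> l \<in> B \<Longrightarrow> X \<longlonglongrightarrow> l \<Longrightarrow> P l"
  shows "P x"
proof -
  have sums: "P y" if "y \<in> crossed_sums" for y
    using that
  proof (induction rule: crossed_sums.induct)
    case (add y z)
    then show ?case using crossed_sums_subset by (intro assms(3)) auto
  qed (rule mono)
  obtain X where X: "\<And>n. X n \<in> crossed_sums" "X \<longlonglongrightarrow> x"
    using x unfolding crossed_product_eq_closure closure_sequential by blast
  show ?thesis
  proof (rule lim[OF _ _ x X(2)])
    show "X n \<in> B" "P (X n)" for n using X(1)[of n] crossed_sums_subset sums by blast+
  qed
qed

section \<open>Compression to the diagonal is the canonical expectation\<close>

lemma diagonal_monomial: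
  "diagonal (\<sigma> a * translation s) = (if s = 0 then \<sigma> a else 0)"
  unfolding crossed_embedding_eq_diag
  by (simp add: diagonal_diag[OF norm_rep_action_le] diagonal_diag_left_translation[OF norm_rep_action_le])

lemma diagonal_tendsto: "X \<longlonglongrightarrow> l \<Longrightarrow> (\<lambda>n. diagonal (X n)) \<longlonglongrightarrow> diagonal (l :: ('g, 'h) ell2 bop)"
proof (rule LIM_zero_cancel, rule Lim_null_comparison)
  assume "X \<longlonglongrightarrow> l"
  then show "(\<lambda>n. norm (X n - l)) \<longlonglongrightarrow> 0" by (intro tendsto_norm_zero LIM_zero)
qed (simp add: diagonal_diff[symmetric] norm_diagonal_le)

text \<open>Clear for sums of monomials; limits stay in the range because \<open>\<sigma>\<close> is
  isometric and hence has closed range.\<close>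

lemma diagonal_in_range: "x \<in> B \<Longrightarrow> diagonal x \<in> range \<sigma>"
proof (induction rule: crossed_product_induct)
  case (monomial a s)
  have "0 = \<sigma> 0" by (simp add: star_hom_zero[OF star_hom_embedding])
  then show ?case by (simp add: diagonal_monomial)
next
  case (add y z)
  then show ?case by (auto simp: diagonal_add star_hom_add[OF star_hom_embedding, symmetric])
next
  case (limit X l)
  show ?case
    by (rule closed_sequentially[OF closed_range_injective_star_hom[OF star_hom_embedding inj_embedding]
          _ diagonal_tendsto]) (use limit in auto)
qed

lemma diagonal_embedding: "diagonal (\<sigma> a) = \<sigma> a"
  using diagonal_monomial[of a 0] by simp

text \<open>The compression is a positive operator of the form \<open>\<sigma> a\<close>, so
  \<open>a\<close> has a selfadjoint square root in the algebra, and its image under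
  \<open>\<sigma>\<close> is the required element.\<close>

lemma diagonal_star_mult:
  assumes x: "x \<in> B"
  shows "\<exists>y\<in>range \<sigma>. diagonal (star x * x) = star y * y"
proof -
  have "star x * x \<in> B"
    by (intro subalgebra_mult subalgebra_star subalgebra_crossed_product x)
  then obtain a where a: "diagonal (star x * x) = \<sigma> a" using diagonal_in_range by blast
  have "positive_op (\<sigma> a)" unfolding a[symmetric] by (intro positive_op_diagonal positive_op_star_mult)
  from sqrt_of_positive[OF star_hom_embedding inj_embedding this] obtain z
    where "star z = z" "z * z = a" by blast
  then have "\<sigma> a = star (\<sigma> z) * \<sigma> z"
    by (simp flip: star_hom_star[OF star_hom_embedding] star_hom_mult[OF star_hom_embedding])
  then show ?thesis using a by auto
qed

lemma conditional_expectation_diagonal: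
  "conditional_expectation B (range \<sigma>) (restrict diagonal B)"
proof -
  have E: "restrict diagonal B x = diagonal x" if "x \<in> B" for x
    using that by simp
  have range: "y \<in> B" "diagonal y = y" if "y \<in> range \<sigma>" for y
    using that by (auto simp: embedding_in_crossed_product diagonal_embedding)
  have bimodule: "diagonal (y * x * z) = y * diagonal x * z"
    if y: "y \<in> range \<sigma>" and z: "z \<in> range \<sigma>" for x y z
  proof -
    obtain a b where ab: "y = \<sigma> a" "z = \<sigma> b" using y z by blast
    show ?thesis
      unfolding ab crossed_embedding_eq_diag
      by (rule diagonal_bimodule[OF norm_rep_action_le norm_rep_action_le])
  qed
  note mem = subalgebra_add[OF subalgebra_crossed_product] subalgebra_scaleC[OF subalgebra_crossed_product]
    subalgebra_mult[OF subalgebra_crossed_product] subalgebra_star[OF subalgebra_crossed_product]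
  show ?thesis
    unfolding conditional_expectation_def
    by (intro conjI ballI allI)
      (simp_all add: E mem range diagonal_in_range diagonal_add diagonal_scaleC norm_diagonal_le
        diagonal_star_mult bimodule del: restrict_apply bex_simps)
qed

text \<open>Any candidate is additive and contractive and is prescribed on monomials, so it agrees
  with the compression on their closed span; extensionality settles the values elsewhere.\<close>

lemma canonical_expectation_eq: "x \<in> B \<Longrightarrow> canonical_expectation \<alpha> \<pi> x = diagonal x"
proof -
  have "canonical_expectation \<alpha> \<pi> = restrict diagonal B"
    unfolding canonical_expectation_def
  proof (rule the_equality, intro conjI allI impI)
    show "restrict diagonal B (\<sigma> a * translation s) = 0" if "s \<noteq> 0" for a s
      using that by (simp add: diagonal_monomial subalgebra_mult[OF subalgebra_crossed_product]
          embedding_in_crossed_product translation_in_crossed_product)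
  next
    fix E assume E: "E \<in> extensional B \<and> conditional_expectation B (range \<sigma>) E \<and>
      (\<forall>a. E (\<sigma> a) = \<sigma> a) \<and> (\<forall>a s. s \<noteq> 0 \<longrightarrow> E (\<sigma> a * translation s) = 0)"
    then have add: "\<And>x y. x \<in> B \<Longrightarrow> y \<in> B \<Longrightarrow> E (x + y) = E x + E y"
      and scale: "\<And>c x. x \<in> B \<Longrightarrow> E (c *\<^sub>C x) = c *\<^sub>C E x"
      and norm: "\<And>x. x \<in> B \<Longrightarrow> norm (E x) \<le> norm x"
      by (simp_all add: conditional_expectation_def)
    have diff: "E (x - y) = E x - E y" if "x \<in> B" "y \<in> B" for x y
      using add[of x "(-1) *\<^sub>C y"] scale[of y "-1"] that
        subalgebra_scaleC[OF subalgebra_crossed_product, of y "-1"] by simp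
    have "E x = diagonal x" if "x \<in> B" for x
      using that
    proof (induction rule: crossed_product_induct)
      case (monomial a s)
      then show ?case using E by (simp add: diagonal_monomial)
    next
      case (add y z)
      then show ?case using \<open>\<And>x y. x \<in> B \<Longrightarrow> y \<in> B \<Longrightarrow> E (x + y) = E x + E y\<close>
        by (simp add: diagonal_add)
    next
      case (limit X l)
      have "(\<lambda>n. E (X n)) \<longlonglongrightarrow> E l"
      proof (rule LIM_zero_cancel, rule Lim_null_comparison)
        show "(\<lambda>n. norm (X n - l)) \<longlonglongrightarrow> 0" using limit by (intro tendsto_norm_zero LIM_zero)
        show "\<forall>\<^sub>F n in sequentially. norm (E (X n) - E l) \<le> norm (X n - l)"
        proof (intro always_eventually allI)
          show "norm (E (X n) - E l) \<le> norm (X n - l)" for n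
            unfolding diff[OF limit(1,2), symmetric]
            by (rule norm[OF subalgebra_diff[OF subalgebra_crossed_product limit(1,2)]])
        qed
      qed
      then show ?case using limit diagonal_tendsto[of X l] LIMSEQ_unique by auto
    qed
    then show "E = restrict diagonal B" using E by (intro extensionalityI[of _ B]) auto
  qed (auto simp: conditional_expectation_diagonal diagonal_embedding embedding_in_crossed_product)
  then show "x \<in> B \<Longrightarrow> canonical_expectation \<alpha> \<pi> x = diagonal x" by simp
qed

end

section \<open>Averaging by a probability measure\<close>

lemma pmf_has_sum_one: "(pmf \<mu> has_sum 1) UNIV"
proof -
  have abs: "pmf \<mu> abs_summable_on UNIV" by (rule pmf_abs_summable)
  then have "pmf \<mu> summable_on UNIV"
    using abs_summable_equivalent abs_summable_summable by blast
  moreover have "infsum (pmf \<mu>) UNIV = 1"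
    using infsetsum_infsum[OF abs] infsetsum_pmf_eq_1[of \<mu> UNIV] by simp
  ultimately show ?thesis by (metis has_sum_infsum)
qed

lemma inner_action_add: "inner_action s (x + y) = inner_action s x + inner_action s y"
  by (simp add: inner_action_eq distrib_left distrib_right)

lemma inner_action_scaleC: "inner_action s (c *\<^sub>C x) = c *\<^sub>C inner_action s x"
  by (simp add: inner_action_eq mult_scaleC_left mult_scaleC_right)

lemma inner_action_one [simp]: "inner_action s 1 = 1"
  by (simp add: inner_action_eq)

lemma norm_left_translation_le: "norm (left_translation s :: ('g::group_add, 'h::chilbert_space) ell2 bop) \<le> 1"
  by (rule norm_le_one_if_star_mult_one) simp

lemma norm_inner_action_le:
  fixes x :: "('g::group_add, 'h::chilbert_space) ell2 bop"
  shows "norm (inner_action s x) \<le> norm x"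
proof -
  have "norm (inner_action s x)
      \<le> norm (left_translation s :: ('g, 'h) ell2 bop) * norm x * norm (left_translation (- s) :: ('g, 'h) ell2 bop)"
    unfolding inner_action_eq
    by (intro order_trans[OF norm_mult_ineq] mult_right_mono norm_mult_ineq norm_ge_zero)
  also have "\<dots> \<le> 1 * norm x * 1"
    by (intro mult_mono norm_left_translation_le mult_nonneg_nonneg) auto
  finally show ?thesis by simp
qed

lemma positive_op_inner_action: "positive_op x \<Longrightarrow> positive_op (inner_action s x)"
  using positive_op_conjugate[of x "left_translation (- s)"] by (simp add: inner_action_eq)

text \<open>The predual form of convolution: the inverse \<open>- s\<close> matches the one in
  \<open>translate_state\<close>, so that composing a state with \<open>mean \<mu>\<close> gives its
  convolution with \<open>\<mu>\<close>.\<close>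

definition mean :: "'g::group_add pmf \<Rightarrow> ('g, 'h::chilbert_space) ell2 bop \<Rightarrow> ('g, 'h) ell2 bop" where
  "mean \<mu> x = (\<Sum>\<^sub>\<infinity>s. pmf \<mu> s *\<^sub>R inner_action (- s) x)"

lemma has_sum_pmf_norm: "((\<lambda>s. pmf \<mu> s * norm x) has_sum norm x) UNIV"
  using has_sum_cmult_left[OF pmf_has_sum_one[of \<mu>], of "norm x"] by simp

lemma norm_mean_summand_le: "norm (pmf \<mu> s *\<^sub>R inner_action t x) \<le> pmf \<mu> s * norm x"
  by (simp add: mult_left_mono norm_inner_action_le)

lemma summable_norm_mean: "(\<lambda>s. norm (pmf \<mu> s *\<^sub>R inner_action (- s) x)) summable_on UNIV"
proof (rule Infinite_Sum.abs_summable_on_comparison_test)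
  have "(\<lambda>s. pmf \<mu> s * norm x) summable_on UNIV"
    using has_sum_pmf_norm by (rule has_sum_imp_summable)
  then show "(\<lambda>s. norm (pmf \<mu> s * norm x)) summable_on UNIV" by simp
  show "norm (pmf \<mu> s *\<^sub>R inner_action (- s) x) \<le> norm (pmf \<mu> s * norm x)" for s
    using norm_mean_summand_le[of \<mu> s "- s" x] by simp
qed

lemma has_sum_mean: "((\<lambda>s. pmf \<mu> s *\<^sub>R inner_action (- s) x) has_sum mean \<mu> x) UNIV"
  unfolding mean_def by (rule has_sum_infsum[OF abs_summable_summable[OF summable_norm_mean]])

lemma mean_eqI: "((\<lambda>s. pmf \<mu> s *\<^sub>R inner_action (- s) x) has_sum y) UNIV \<Longrightarrow> mean \<mu> x = y"
  unfolding mean_def by (rule infsumI)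

lemma mean_add: "mean \<mu> (x + y) = mean \<mu> x + mean \<mu> y"
proof (rule mean_eqI)
  show "((\<lambda>s. pmf \<mu> s *\<^sub>R inner_action (- s) (x + y)) has_sum mean \<mu> x + mean \<mu> y) UNIV"
    using has_sum_add[OF has_sum_mean has_sum_mean] by (simp add: inner_action_add scaleR_add_right)
qed

lemma mean_scaleC: "mean \<mu> (c *\<^sub>C x) = c *\<^sub>C mean \<mu> x"
proof (rule mean_eqI)
  show "((\<lambda>s. pmf \<mu> s *\<^sub>R inner_action (- s) (c *\<^sub>C x)) has_sum c *\<^sub>C mean \<mu> x) UNIV"
    using has_sum_bounded_linear[OF bounded_linear_scaleC has_sum_mean]
    by (simp add: inner_action_scaleC scaleC_scaleR_commute)
qed

lemma mean_one: "mean \<mu> 1 = 1"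
proof (rule mean_eqI)
  show "((\<lambda>s. pmf \<mu> s *\<^sub>R inner_action (- s) 1) has_sum 1) UNIV"
    using has_sum_bounded_linear[OF bounded_linear_scaleR_left[of 1] pmf_has_sum_one] by simp
qed

lemma norm_mean_le: "norm (mean \<mu> x) \<le> norm x"
proof -
  have "norm (mean \<mu> x) \<le> (\<Sum>\<^sub>\<infinity>s. norm (pmf \<mu> s *\<^sub>R inner_action (- s) x))"
    unfolding mean_def by (rule norm_infsum_bound[OF summable_norm_mean])
  also have "\<dots> \<le> norm x"
    by (rule has_sum_mono[OF has_sum_infsum[OF summable_norm_mean] has_sum_pmf_norm])
      (rule norm_mean_summand_le)
  finally show ?thesis .
qed

lemma bounded_linear_vector_functional:
  fixes \<xi> :: "'h::chilbert_space"
  shows "bounded_linear (\<lambda>x. cinner (bop_apply x \<xi>) \<eta>)"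
proof (rule bounded_linear_intro[where K = "norm \<xi> * norm \<eta>"])
  fix x y :: "'h bop" and r :: real
  have "norm (cinner (bop_apply x \<xi>) \<eta>) \<le> norm (bop_apply x \<xi>) * norm \<eta>" by (rule norm_cinner_le)
  also have "\<dots> \<le> norm x * norm \<xi> * norm \<eta>" by (intro mult_right_mono norm_bop) simp
  finally show "norm (cinner (bop_apply x \<xi>) \<eta>) \<le> norm x * (norm \<xi> * norm \<eta>)" by (simp only: mult.assoc)
  show "cinner (bop_apply (r *\<^sub>R x) \<xi>) \<eta> = r *\<^sub>R cinner (bop_apply x \<xi>) \<eta>"
    unfolding scaleR_bop_apply by (simp add: scaleR_scaleC[where 'a = 'h] cinner_scaleC_left scaleR_conv_of_real)
qed (simp add: plus_bop.rep_eq cinner_add_left)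

text \<open>The quadratic form is continuous in the operator, so it can be evaluated term by
  term.\<close>

lemma positive_op_mean:
  assumes x: "positive_op x"
  shows "positive_op (mean \<mu> x)"
  unfolding positive_op_def
proof
  fix \<xi>
  have "cinner (bop_apply (mean \<mu> x) \<xi>) \<xi>
      = (\<Sum>\<^sub>\<infinity>s. cinner (bop_apply (pmf \<mu> s *\<^sub>R inner_action (- s) x) \<xi>) \<xi>)"
    by (rule infsumI[symmetric], rule has_sum_bounded_linear[OF bounded_linear_vector_functional has_sum_mean])
  also have "\<dots> \<in> \<real>\<^sub>\<ge>\<^sub>0"
  proof (rule infsum_nonneg_Reals)
    show "cinner (bop_apply (pmf \<mu> s *\<^sub>R inner_action (- s) x) \<xi>) \<xi> \<in> \<real>\<^sub>\<ge>\<^sub>0" for s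
      using positive_op_scaleR[OF pmf_nonneg positive_op_inner_action[OF x], of \<mu> s "- s"]
      unfolding positive_op_def by blast
  qed
  finally show "cinner (bop_apply (mean \<mu> x) \<xi>) \<xi> \<in> \<real>\<^sub>\<ge>\<^sub>0" .
qed

section \<open>Cesaro averages of the iterates of the mean\<close>

definition cesaro :: "'g::group_add pmf \<Rightarrow> nat \<Rightarrow> ('g, 'h::chilbert_space) ell2 bop \<Rightarrow> ('g, 'h) ell2 bop" where
  "cesaro \<mu> n x = (1 / real (Suc n)) *\<^sub>R (\<Sum>k\<le>n. (mean \<mu> ^^ k) x)"

lemma mean_pow_add: "(mean \<mu> ^^ k) (x + y) = (mean \<mu> ^^ k) x + (mean \<mu> ^^ k) y"
  by (induction k) (simp_all add: mean_add)

lemma mean_pow_scaleC: "(mean \<mu> ^^ k) (c *\<^sub>C x) = c *\<^sub>C (mean \<mu> ^^ k) x"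
  by (induction k) (simp_all add: mean_scaleC)

lemma mean_pow_one: "(mean \<mu> ^^ k) 1 = 1"
  by (induction k) (simp_all add: mean_one)

lemma norm_mean_pow_le: "norm ((mean \<mu> ^^ k) x) \<le> norm x"
proof (induction k)
  case (Suc k)
  then show ?case using norm_mean_le[of \<mu> "(mean \<mu> ^^ k) x"] by simp
qed simp

lemma positive_op_mean_pow: "positive_op x \<Longrightarrow> positive_op ((mean \<mu> ^^ k) x)"
  by (induction k) (simp_all add: positive_op_mean)

lemma scaleC_sum_right: "c *\<^sub>C (\<Sum>i\<in>I. f i) = (\<Sum>i\<in>I. c *\<^sub>C (f i :: 'a::complex_vector))"
  by (induction I rule: infinite_finite_induct) (simp_all add: scaleC_add_right)

lemma cesaro_add: "cesaro \<mu> n (x + y) = cesaro \<mu> n x + cesaro \<mu> n y"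
  by (simp add: cesaro_def mean_pow_add sum.distrib scaleR_add_right)

lemma cesaro_scaleC: "cesaro \<mu> n (c *\<^sub>C x) = c *\<^sub>C cesaro \<mu> n x"
  unfolding cesaro_def mean_pow_scaleC scaleC_sum_right[symmetric] by (rule scaleC_scaleR_commute[symmetric])

lemma cesaro_one: "cesaro \<mu> n 1 = 1"
  unfolding cesaro_def mean_pow_one sum_constant_scaleR card_atMost by (simp del: of_nat_Suc)

lemma norm_cesaro_le: "norm (cesaro \<mu> n x) \<le> norm x"
proof -
  have "norm (\<Sum>k\<le>n. (mean \<mu> ^^ k) x) \<le> (\<Sum>k\<le>n. norm x)"
    by (intro order_trans[OF norm_sum] sum_mono norm_mean_pow_le)
  then show ?thesis by (simp add: cesaro_def field_simps)
qed

text \<open>The difference telescopes to two terms divided by \<open>Suc n\<close>. This asymptotic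
  invariance makes cluster points of averaged functionals stationary.\<close>

lemma norm_cesaro_mean_diff_le: "norm (cesaro \<mu> n (mean \<mu> x) - cesaro \<mu> n x) \<le> 2 * norm x / real (Suc n)"
proof -
  have "(mean \<mu> ^^ k) (mean \<mu> x) = (mean \<mu> ^^ Suc k) x" for k by (simp add: funpow_swap1)
  then have "cesaro \<mu> n (mean \<mu> x) - cesaro \<mu> n x
      = (1 / real (Suc n)) *\<^sub>R (\<Sum>k\<le>n. (mean \<mu> ^^ Suc k) x - (mean \<mu> ^^ k) x)"
    by (simp add: cesaro_def sum_subtractf scaleR_diff_right del: funpow.simps)
  also have "(\<Sum>k\<le>n. (mean \<mu> ^^ Suc k) x - (mean \<mu> ^^ k) x) = (mean \<mu> ^^ Suc n) x - (mean \<mu> ^^ 0) x"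
    unfolding lessThan_Suc_atMost[symmetric] by (rule sum_lessThan_telescope)
  finally have "norm (cesaro \<mu> n (mean \<mu> x) - cesaro \<mu> n x)
      = norm ((mean \<mu> ^^ Suc n) x - (mean \<mu> ^^ 0) x) / real (Suc n)"
    by (simp del: funpow.simps)
  also have "norm ((mean \<mu> ^^ Suc n) x - (mean \<mu> ^^ 0) x) \<le> norm x + norm x"
    by (intro order_trans[OF norm_triangle_ineq4] add_mono norm_mean_pow_le)
  finally show ?thesis by (simp add: divide_right_mono)
qed

lemma positive_op_sum: "(\<And>i. i \<in> I \<Longrightarrow> positive_op (f i)) \<Longrightarrow> positive_op (sum f I)"
proof (induction I rule: infinite_finite_induct)
  case (infinite I)
  then show ?case by (simp add: positive_op_def zero_bop.rep_eq)
next
  case empty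
  then show ?case by (simp add: positive_op_def zero_bop.rep_eq)
qed (simp add: positive_op_add)

lemma positive_op_cesaro: "positive_op x \<Longrightarrow> positive_op (cesaro \<mu> n x)"
  unfolding cesaro_def by (intro positive_op_scaleR positive_op_sum positive_op_mean_pow) auto

subsection \<open>Stationary states\<close>

context
  fixes B :: "('g::group_add, 'h::chilbert_space) ell2 bop set"
  assumes B: "cstar_subalgebra B" and translation_mem: "\<And>s. left_translation s \<in> B"
begin

lemma one_in_subalgebra: "1 \<in> B"
  using translation_mem[of 0] by simp

lemma inner_action_in_subalgebra: "x \<in> B \<Longrightarrow> inner_action s x \<in> B"
  unfolding inner_action_eq by (intro subalgebra_mult[OF B] translation_mem)

lemma mean_in_subalgebra:
  assumes x: "x \<in> B"
  shows "mean \<mu> x \<in> B"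
proof (rule Lim_in_closed_set[OF subalgebra_closed[OF B]])
  show "(sum (\<lambda>s. pmf \<mu> s *\<^sub>R inner_action (- s) x) \<longlongrightarrow> mean \<mu> x) (finite_subsets_at_top UNIV)"
    using has_sum_mean unfolding has_sum_def .
  show "\<forall>\<^sub>F F in finite_subsets_at_top UNIV. (\<Sum>s\<in>F. pmf \<mu> s *\<^sub>R inner_action (- s) x) \<in> B"
    by (intro always_eventually allI subalgebra_sum[OF B] subalgebra_scaleR[OF B]
        inner_action_in_subalgebra x)
qed simp

lemma mean_pow_in_subalgebra: "x \<in> B \<Longrightarrow> (mean \<mu> ^^ k) x \<in> B"
  by (induction k) (simp_all add: mean_in_subalgebra)

lemma cesaro_in_subalgebra: "x \<in> B \<Longrightarrow> cesaro \<mu> n x \<in> B"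
  unfolding cesaro_def by (intro subalgebra_scaleR[OF B] subalgebra_sum[OF B] mean_pow_in_subalgebra)

lemma convolve_eq_mean:
  assumes \<phi>: "state_on B \<phi>" and x: "x \<in> B"
  shows "convolve inner_action \<mu> \<phi> x = \<phi> (mean \<mu> x)"
proof -
  have "((\<lambda>s. \<phi> (pmf \<mu> s *\<^sub>R inner_action (- s) x)) has_sum \<phi> (mean \<mu> x)) UNIV"
    by (rule state_has_sum[OF B one_in_subalgebra \<phi> _ _ has_sum_mean])
      (intro subalgebra_scaleR[OF B] inner_action_in_subalgebra mean_in_subalgebra x)+
  moreover have "\<phi> (pmf \<mu> s *\<^sub>R inner_action (- s) x)
      = complex_of_real (pmf \<mu> s) * translate_state inner_action s \<phi> x" for s
    unfolding translate_state_def
    by (rule state_scaleR[OF B one_in_subalgebra \<phi> inner_action_in_subalgebra[OF x]])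
  ultimately show ?thesis unfolding convolve_def by (intro infsumI) simp
qed

lemma stationary_cesaro:
  assumes \<phi>: "state_on B \<phi>" and stat: "stationary_on B inner_action \<mu> \<phi>" and x: "x \<in> B"
  shows "\<phi> (cesaro \<mu> n x) = \<phi> x"
proof -
  have mean: "\<phi> (mean \<mu> y) = \<phi> y" if "y \<in> B" for y
    using stat convolve_eq_mean[OF \<phi> that, of \<mu>] that unfolding stationary_on_def by metis
  have pow: "\<phi> ((mean \<mu> ^^ k) x) = \<phi> x" for k
    by (induction k) (simp_all add: mean mean_pow_in_subalgebra[OF x])
  have "\<phi> (cesaro \<mu> n x) = complex_of_real (1 / real (Suc n)) * \<phi> (\<Sum>k\<le>n. (mean \<mu> ^^ k) x)"
    unfolding cesaro_def
    by (intro state_scaleR[OF B one_in_subalgebra \<phi>] subalgebra_sum[OF B] mean_pow_in_subalgebra x)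
  also have "\<phi> (\<Sum>k\<le>n. (mean \<mu> ^^ k) x) = (\<Sum>k\<le>n. \<phi> ((mean \<mu> ^^ k) x))"
    by (intro state_sum[OF B one_in_subalgebra \<phi>] mean_pow_in_subalgebra x)
  also have "\<dots> = of_nat (Suc n) * \<phi> x" unfolding pow by (simp only: sum_constant card_atMost)
  finally show ?thesis by (simp del: of_nat_Suc)
qed

end

section \<open>Averages of translations tend to zero\<close>

text \<open>Weak-* compactness of the unit ball of the dual, in the form of a cluster point.\<close>

lemma bounded_functionals_cluster_point:
  fixes \<phi> :: "nat \<Rightarrow> 'a::real_normed_vector \<Rightarrow> complex"
  assumes bound: "\<And>n x. cmod (\<phi> n x) \<le> norm x"
  obtains f where "\<And>C. closed C \<Longrightarrow> \<forall>\<^sub>F n in sequentially. \<phi> n \<in> C \<Longrightarrow> f \<in> C"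
proof -
  \<comment> \<open>A product of closed discs, compact by Tychonoff in the topology of pointwise
    convergence.\<close>
  define K where "K = (\<Pi>\<^sub>E x\<in>UNIV. cball (0 :: complex) (norm (x :: 'a)))"
  have "compactin (product_topology (\<lambda>_. euclidean) UNIV) K"
    unfolding K_def by (simp add: compactin_PiE)
  then have "compact K" by (simp add: euclidean_product_topology)
  moreover have "\<phi> n \<in> K" for n by (simp add: K_def PiE_iff bound)
  ultimately obtain f where f: "inf (nhds f) (filtermap \<phi> sequentially) \<noteq> bot"
    unfolding compact_filter
    by (metis (no_types, lifting) always_eventually eventually_filtermap filtermap_bot_iff sequentially_bot)
  have "f \<in> C" if C: "closed C" "\<forall>\<^sub>F n in sequentially. \<phi> n \<in> C" for C
  proof (rule ccontr)
    assume "f \<notin> C"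
    then have "\<forall>\<^sub>F g in nhds f. g \<in> - C" using C(1) by (intro eventually_nhds_in_open) auto
    moreover have "\<forall>\<^sub>F g in filtermap \<phi> sequentially. g \<in> C" using C(2) by (simp add: eventually_filtermap)
    ultimately have "\<forall>\<^sub>F g in inf (nhds f) (filtermap \<phi> sequentially). False"
      unfolding eventually_inf by (metis ComplD)
    then show False using f by (simp add: trivial_limit_def[symmetric])
  qed
  then show ?thesis by (rule that)
qed

text \<open>If every unit vector gave a value of at most \<open>e / 4\<close>, the numerical radius
  bound would yield \<open>norm x \<le> e / 2\<close>, which is less than \<open>e\<close>.\<close>

lemma exists_vector_state_large:
  fixes x :: "'h::chilbert_space bop"
  assumes e: "0 < e" "e \<le> norm x"
  shows "\<exists>\<xi>. norm \<xi> = 1 \<and> e / 4 \<le> cmod (cinner (bop_apply x \<xi>) \<xi>)"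
proof (rule ccontr)
  assume "\<not> ?thesis"
  then have small: "cmod (cinner (bop_apply x \<xi>) \<xi>) \<le> e / 4" if "norm \<xi> = 1" for \<xi>
    using that by (meson linear)
  have "cmod (cinner (bop_apply x \<xi>) \<xi>) \<le> e / 4 * (norm \<xi>)\<^sup>2" for \<xi>
  proof (cases "\<xi> = 0")
    case False
    define \<eta> where "\<eta> = (1 / norm \<xi>) *\<^sub>R \<xi>"
    have \<eta>: "norm \<eta> = 1" "\<xi> = complex_of_real (norm \<xi>) *\<^sub>C \<eta>"
      using False by (simp_all add: \<eta>_def scaleR_scaleC[symmetric])
    have "cinner (bop_apply x \<xi>) \<xi> = complex_of_real ((norm \<xi>)\<^sup>2) * cinner (bop_apply x \<eta>) \<eta>"
      by (subst (1 2) \<eta>(2)) (simp add: bop_scaleC cinner_scaleC_left cinner_scaleC_right power2_eq_square)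
    then have "cmod (cinner (bop_apply x \<xi>) \<xi>) = (norm \<xi>)\<^sup>2 * cmod (cinner (bop_apply x \<eta>) \<eta>)"
      by (simp only: norm_mult norm_of_real abs_power2)
    also have "\<dots> \<le> (norm \<xi>)\<^sup>2 * (e / 4)" by (intro mult_left_mono small \<eta>(1)) simp
    finally show ?thesis by (simp add: mult.commute)
  qed simp
  then have "norm x \<le> 2 * (e / 4)" using e by (intro norm_le_numerical_radius) auto
  then show False using e by linarith
qed

lemma reduced_cstar_subalgebra: "cstar_subalgebra reduced_cstar"
  unfolding reduced_cstar_def by (rule cstar_subalgebra_generated)

lemma left_translation_in_reduced_cstar: "left_translation s \<in> reduced_cstar"
  unfolding reduced_cstar_def by (rule subsetD[OF generators_subset]) blast

text \<open>Otherwise vector states that do not vanish on the averages would accumulate at a second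
  stationary state.\<close>

lemma cesaro_left_translation_small:
  fixes \<mu> :: "'g::group_add pmf"
  assumes \<mu>: "cstar_simple_measure \<mu>" and s: "s \<noteq> 0" and e: "0 < e"
  shows "\<exists>n. norm (cesaro \<mu> n (left_translation s :: ('g, complex) ell2 bop)) < e"
proof (rule ccontr)
  let ?L = "left_translation s :: ('g, complex) ell2 bop"
  assume "\<not> ?thesis"
  then have "\<exists>\<xi>. norm \<xi> = 1 \<and> e / 4 \<le> cmod (cinner (bop_apply (cesaro \<mu> n ?L) \<xi>) \<xi>)" for n
    using e by (intro exists_vector_state_large) (auto simp: not_less)
  then obtain X where X: "\<And>n. norm (X n) = 1"
    and large: "\<And>n. e / 4 \<le> cmod (cinner (bop_apply (cesaro \<mu> n ?L) (X n)) (X n))" by metis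
  define \<phi> where "\<phi> n x = cinner (bop_apply (cesaro \<mu> n x) (X n)) (X n)" for n x
  have vector: "cmod (cinner (bop_apply y (X n)) (X n)) \<le> norm y" for n y
    using norm_cinner_le[of "bop_apply y (X n)" "X n"] norm_bop[of y "X n"] X[of n] by simp
  have bound: "cmod (\<phi> n x) \<le> norm x" for n x
    unfolding \<phi>_def by (rule order_trans[OF vector norm_cesaro_le])
  from bounded_functionals_cluster_point[of \<phi>, OF bound] obtain f
    where f: "\<And>C. closed C \<Longrightarrow> \<forall>\<^sub>F n in sequentially. \<phi> n \<in> C \<Longrightarrow> f \<in> C" by blast
  \<comment> \<open>Each property of a stationary state is a closed condition on finitely many
    values, so it passes from the \<open>\<phi> n\<close> to the cluster point.\<close>
  have add: "f (x + y) = f x + f y" for x y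
  proof -
    have "f \<in> {g. g (x + y) = g x + g y}"
      by (rule f) (auto intro!: closed_Collect_eq continuous_intros simp: \<phi>_def cesaro_add plus_bop.rep_eq cinner_add_left)
    then show ?thesis by simp
  qed
  have scale: "f (c *\<^sub>C x) = c * f x" for c x
  proof -
    have "f \<in> {g. g (c *\<^sub>C x) = c * g x}"
      by (rule f) (auto intro!: closed_Collect_eq continuous_intros simp: \<phi>_def cesaro_scaleC scaleC_bop.rep_eq cinner_scaleC_left)
    then show ?thesis by simp
  qed
  have one: "f 1 = 1"
  proof -
    have "f \<in> {g. g 1 = 1}"
      by (rule f) (auto intro!: closed_Collect_eq continuous_intros simp: \<phi>_def cesaro_one one_bop.rep_eq cinner_self X)
    then show ?thesis by simp
  qed
  have pos: "f (star x * x) \<in> \<real>\<^sub>\<ge>\<^sub>0" for x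
  proof -
    have "\<phi> n (star x * x) \<in> \<real>\<^sub>\<ge>\<^sub>0" for n
      using positive_op_cesaro[OF positive_op_star_mult[of x]] by (simp add: \<phi>_def positive_op_def)
    then have "f \<in> {g. 0 \<le> Re (g (star x * x)) \<and> Im (g (star x * x)) = 0}"
      by (intro f) (auto intro!: closed_Collect_conj closed_Collect_eq closed_Collect_le continuous_intros
          simp: complex_nonneg_Reals_iff)
    then show ?thesis by (simp add: complex_nonneg_Reals_iff)
  qed
  have large_f: "e / 4 \<le> cmod (f ?L)"
  proof -
    have "\<phi> n \<in> {g. e / 4 \<le> cmod (g ?L)}" for n using large[of n] by (simp add: \<phi>_def)
    then have "f \<in> {g. e / 4 \<le> cmod (g ?L)}"
      by (intro f closed_Collect_le always_eventually) (auto intro!: continuous_intros)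
    then show ?thesis by simp
  qed
  have mean: "f (mean \<mu> x) = f x" for x
  proof -
    \<comment> \<open>Approximate invariance with this constant holds only from index
      \<open>N\<close> on, which suffices for a cluster point; afterwards \<open>N\<close> tends to
      infinity.\<close>
    have close: "cmod (f (mean \<mu> x) - f x) \<le> 2 * norm x / real (Suc N)" for N
    proof -
      have "cmod (\<phi> n (mean \<mu> x) - \<phi> n x) \<le> 2 * norm x / real (Suc N)" if "N \<le> n" for n
      proof -
        have "\<phi> n (mean \<mu> x) - \<phi> n x = cinner (bop_apply (cesaro \<mu> n (mean \<mu> x) - cesaro \<mu> n x) (X n)) (X n)"
          by (simp add: \<phi>_def minus_bop_apply cinner_diff_left)
        then have "cmod (\<phi> n (mean \<mu> x) - \<phi> n x) \<le> 2 * norm x / real (Suc n)"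
          using order_trans[OF vector norm_cesaro_mean_diff_le] by simp
        also have "\<dots> \<le> 2 * norm x / real (Suc N)" using that by (intro divide_left_mono) auto
        finally show ?thesis .
      qed
      then have "f \<in> {g. cmod (g (mean \<mu> x) - g x) \<le> 2 * norm x / real (Suc N)}"
        by (intro f) (auto intro!: closed_Collect_le continuous_intros eventually_sequentiallyI[of N] simp del: of_nat_Suc)
      then show ?thesis by simp
    qed
    have "(\<lambda>N. 2 * norm x * (1 / real (Suc N))) \<longlonglongrightarrow> 2 * norm x * 0"
      by (intro tendsto_mult tendsto_const lim_inverse_n'[THEN LIMSEQ_Suc])
    then have "cmod (f (mean \<mu> x) - f x) \<le> 0"
      using close by (intro LIMSEQ_le_const[of "\<lambda>N. 2 * norm x * (1 / real (Suc N))"]) auto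
    then show ?thesis by simp
  qed
  have state: "state_on reduced_cstar f"
    using add scale one pos by (simp add: state_on_def)
  moreover have "stationary_on reduced_cstar inner_action \<mu> f"
    unfolding stationary_on_def
    using convolve_eq_mean[OF reduced_cstar_subalgebra left_translation_in_reduced_cstar state] mean by simp
  \<comment> \<open>Uniqueness forces the value of the trace, which is 0 since
    \<open>s \<noteq> 0\<close>, against the lower bound \<open>e / 4\<close>.\<close>
  ultimately have "f ?L = canonical_trace ?L"
    using \<mu> left_translation_in_reduced_cstar unfolding cstar_simple_measure_def Let_def by blast
  then show False using large_f e s by (simp add: canonical_trace_left_translation)
qed

section \<open>Domination by scalar operators\<close>

text \<open>Replacing fibre vectors by their lengths gives a norm-preserving passage to scalar
  sequences, which commutes with translations.\<close>

lift_definition modulus :: "('g, 'h::complex_inner) ell2 \<Rightarrow> ('g, complex) ell2"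
  is "\<lambda>\<xi> t. complex_of_real (norm (\<xi> t))"
  by (simp add: square_summable_def)

lemma norm_modulus [simp]: "norm (modulus \<xi>) = norm \<xi>"
  by transfer (simp add: l2norm_def)

lemma modulus_left_translation:
  "modulus (bop_apply (left_translation s) \<xi>) = bop_apply (left_translation s) (modulus \<xi>)"
  by (rule ell2_eqI) (simp add: modulus.rep_eq left_translation_apply)

text \<open>The point of this relation is that it survives averaging over the group with nonnegative weights,
  whatever the coefficients in \<open>\<A>\<close> are.\<close>

definition dominated ::
  "('g, 'h::chilbert_space) ell2 bop \<Rightarrow> ('g, complex) ell2 bop \<Rightarrow> bool" where
  "dominated x y \<longleftrightarrow> (\<forall>\<xi> t. norm (ell2_apply (bop_apply x \<xi>) t) \<le> Re (ell2_apply (bop_apply y (modulus \<xi>)) t))"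

lemma dominatedD:
  "dominated x y \<Longrightarrow> norm (ell2_apply (bop_apply x \<xi>) t) \<le> Re (ell2_apply (bop_apply y (modulus \<xi>)) t)"
  by (simp add: dominated_def)

lemma norm_ell2_mono:
  assumes "\<And>t. norm (ell2_apply \<xi> t) \<le> norm (ell2_apply \<eta> t)"
  shows "norm \<xi> \<le> norm \<eta>"
proof -
  have "L2_set (\<lambda>t. norm (ell2_apply \<xi> t)) F \<le> l2norm (ell2_apply \<eta>)" if "finite F" for F
    by (rule order_trans[OF L2_set_mono L2_set_le_l2norm[OF square_summable_ell2 that]])
      (simp_all add: assms)
  then show ?thesis unfolding norm_ell2.rep_eq by (rule square_summable_bound(2))
qed

text \<open>Pointwise domination compares the lengths of the images, and \<open>modulus\<close>
  preserves the norm of the argument.\<close>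

lemma norm_le_if_dominated:
  assumes "dominated x y"
  shows "norm x \<le> norm y"
proof (rule norm_bop_bound)
  fix \<xi>
  have "norm (bop_apply x \<xi>) \<le> norm (bop_apply y (modulus \<xi>))"
    by (rule norm_ell2_mono) (rule order_trans[OF dominatedD[OF assms] complex_Re_le_cmod])
  also have "\<dots> \<le> norm y * norm \<xi>" using norm_bop[of y "modulus \<xi>"] by simp
  finally show "norm (bop_apply x \<xi>) \<le> norm y * norm \<xi>" .
qed simp

lemma dominated_zero: "dominated 0 0"
  by (simp add: dominated_def zero_bop.rep_eq zero_ell2.rep_eq)

lemma dominated_add:
  assumes "dominated x y" "dominated x' y'"
  shows "dominated (x + x') (y + y')"
  unfolding dominated_def
proof (intro allI)
  fix \<xi> t
  show "norm (ell2_apply (bop_apply (x + x') \<xi>) t) \<le> Re (ell2_apply (bop_apply (y + y') (modulus \<xi>)) t)"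
    using norm_triangle_ineq[of "ell2_apply (bop_apply x \<xi>) t" "ell2_apply (bop_apply x' \<xi>) t"]
      dominatedD[OF assms(1), of \<xi> t] dominatedD[OF assms(2), of \<xi> t]
    by (simp add: plus_bop.rep_eq plus_ell2.rep_eq)
qed

lemma scaleR_ell2_apply: "ell2_apply (r *\<^sub>R \<xi>) t = r *\<^sub>R ell2_apply \<xi> t"
  by (simp add: scaleR_scaleC scaleC_ell2.rep_eq)

lemma dominated_scaleR:
  assumes "0 \<le> r" "dominated x y"
  shows "dominated (r *\<^sub>R x) (r *\<^sub>R y)"
  unfolding dominated_def
proof (intro allI)
  fix \<xi> t
  show "norm (ell2_apply (bop_apply (r *\<^sub>R x) \<xi>) t) \<le> Re (ell2_apply (bop_apply (r *\<^sub>R y) (modulus \<xi>)) t)"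
    unfolding scaleR_bop_apply scaleR_ell2_apply
    using mult_left_mono[OF dominatedD[OF assms(2), of \<xi> t] assms(1)] assms(1) by simp
qed

lemma dominated_sum:
  "(\<And>i. i \<in> I \<Longrightarrow> dominated (f i) (g i)) \<Longrightarrow> dominated (sum f I) (sum g I)"
  by (induction I rule: infinite_finite_induct) (simp_all add: dominated_zero dominated_add)

text \<open>Conjugation translates the argument and shifts the point of evaluation; both are
  compatible with \<open>modulus\<close>.\<close>

lemma dominated_inner_action:
  assumes "dominated x y"
  shows "dominated (inner_action s x) (inner_action s y)"
  unfolding dominated_def inner_action_eq
  using dominatedD[OF assms]
  by (simp add: times_bop.rep_eq left_translation_apply modulus_left_translation[symmetric])

lemma ell2_eval_tendsto:
  fixes f :: "'i \<Rightarrow> ('g, 'h::chilbert_space) ell2 bop"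
  assumes "(f \<longlongrightarrow> x) F"
  shows "((\<lambda>i. ell2_apply (bop_apply (f i) \<xi>) t) \<longlongrightarrow> ell2_apply (bop_apply x \<xi>) t) F"
proof (rule LIM_zero_cancel, rule Lim_null_comparison)
  have "norm (ell2_apply (bop_apply (f i) \<xi>) t - ell2_apply (bop_apply x \<xi>) t) \<le> norm (f i - x) * norm \<xi>" for i
    using order_trans[OF norm_ell2_apply_le norm_bop, of "f i - x" \<xi> t]
    by (simp add: minus_bop_apply minus_ell2.rep_eq)
  then show "\<forall>\<^sub>F i in F. norm (ell2_apply (bop_apply (f i) \<xi>) t - ell2_apply (bop_apply x \<xi>) t) \<le> norm (f i - x) * norm \<xi>"
    by simp
  show "((\<lambda>i. norm (f i - x) * norm \<xi>) \<longlongrightarrow> 0) F"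
    using tendsto_mult_left_zero[OF tendsto_norm_zero[OF LIM_zero[OF assms]]] .
qed

text \<open>Finite partial sums have nonnegative weights and stay dominated; norm convergence of
  operators gives convergence at each vector and point.\<close>

lemma dominated_mean:
  assumes "dominated x y"
  shows "dominated (mean \<mu> x) (mean \<mu> y)"
  unfolding dominated_def
proof (intro allI)
  fix \<xi> t
  let ?F = "finite_subsets_at_top UNIV"
  let ?x = "\<lambda>F. \<Sum>s\<in>F. pmf \<mu> s *\<^sub>R inner_action (- s) x"
  let ?y = "\<lambda>F. \<Sum>s\<in>F. pmf \<mu> s *\<^sub>R inner_action (- s) y"
  have lim: "(?x \<longlongrightarrow> mean \<mu> x) ?F" "(?y \<longlongrightarrow> mean \<mu> y) ?F"
    using has_sum_mean[of \<mu> x] has_sum_mean[of \<mu> y] unfolding has_sum_def by simp_all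
  have "dominated (?x F) (?y F)" for F
    by (intro dominated_sum dominated_scaleR dominated_inner_action assms pmf_nonneg)
  then have "norm (ell2_apply (bop_apply (?x F) \<xi>) t) \<le> Re (ell2_apply (bop_apply (?y F) (modulus \<xi>)) t)" for F
    by (rule dominatedD)
  then show "norm (ell2_apply (bop_apply (mean \<mu> x) \<xi>) t) \<le> Re (ell2_apply (bop_apply (mean \<mu> y) (modulus \<xi>)) t)"
    by (intro tendsto_le[OF _ tendsto_Re[OF ell2_eval_tendsto[OF lim(2)]] tendsto_norm[OF ell2_eval_tendsto[OF lim(1)]]])
      auto
qed

lemma dominated_cesaro:
  assumes "dominated x y"
  shows "dominated (cesaro \<mu> n x) (cesaro \<mu> n y)"
proof -
  have "dominated ((mean \<mu> ^^ k) x) ((mean \<mu> ^^ k) y)" for k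
    by (induction k) (simp_all add: assms dominated_mean)
  then show ?thesis unfolding cesaro_def by (intro dominated_scaleR dominated_sum) auto
qed

section \<open>Stationary states on the crossed product\<close>

context crossed_system
begin

lemma dominated_monomial: "dominated (\<sigma> a * translation s) (norm a *\<^sub>R left_translation s)"
  unfolding dominated_def
proof (intro allI)
  fix \<xi> t
  have "norm (ell2_apply (bop_apply (\<sigma> a * translation s) \<xi>) t) \<le> norm (\<pi> (\<alpha> (- t) a)) * norm (ell2_apply \<xi> (- s + t))"
    by (simp add: times_bop.rep_eq embedding_apply left_translation_apply norm_bop)
  also have "\<dots> \<le> norm a * norm (ell2_apply \<xi> (- s + t))"
    by (intro mult_right_mono norm_rep_action_le) simp
  finally show "norm (ell2_apply (bop_apply (\<sigma> a * translation s) \<xi>) t)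
      \<le> Re (ell2_apply (bop_apply (norm a *\<^sub>R left_translation s) (modulus \<xi>)) t)"
    by (simp add: scaleR_bop_apply scaleR_ell2_apply left_translation_apply modulus.rep_eq)
qed

text \<open>Averaging leaves the value of the state unchanged, while domination bounds the averaged
  monomial by \<open>norm a\<close> times the averaged scalar translation, whose norm can be made
  arbitrarily small.\<close>

lemma stationary_state_monomial:
  assumes \<mu>: "cstar_simple_measure \<mu>" and \<tau>: "state_on B \<tau>" "stationary_on B inner_action \<mu> \<tau>"
    and s: "s \<noteq> 0"
  shows "\<tau> (\<sigma> a * translation s) = 0"
proof -
  have mem: "\<sigma> a * translation s \<in> B"
    by (intro subalgebra_mult subalgebra_crossed_product embedding_in_crossed_product translation_in_crossed_product)
  have bound: "cmod (\<tau> (\<sigma> a * translation s))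
      \<le> norm a * norm (cesaro \<mu> n (left_translation s :: ('g, complex) ell2 bop))" for n
  proof -
    have "cmod (\<tau> (\<sigma> a * translation s)) = cmod (\<tau> (cesaro \<mu> n (\<sigma> a * translation s)))"
      using stationary_cesaro[OF subalgebra_crossed_product translation_in_crossed_product \<tau> mem] by simp
    also have "\<dots> \<le> norm (cesaro \<mu> n (\<sigma> a * translation s))"
      by (intro norm_state_le[OF subalgebra_crossed_product one_in_crossed_product \<tau>(1)]
          cesaro_in_subalgebra[OF subalgebra_crossed_product translation_in_crossed_product] mem)
    also have "\<dots> \<le> norm (cesaro \<mu> n (norm a *\<^sub>R left_translation s :: ('g, complex) ell2 bop))"
      by (intro norm_le_if_dominated dominated_cesaro dominated_monomial)
    also have "\<dots> = norm a * norm (cesaro \<mu> n (left_translation s :: ('g, complex) ell2 bop))"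
      by (simp add: scaleR_scaleC cesaro_scaleC)
    finally show ?thesis .
  qed
  have "cmod (\<tau> (\<sigma> a * translation s)) \<le> 0 + e" if e: "0 < e" for e
  proof -
    \<comment> \<open>Dividing by \<open>norm a + 1\<close> rather than \<open>norm a\<close> covers
      \<open>a = 0\<close>.\<close>
    have pos: "0 < norm a + 1" by (simp add: add_nonneg_pos)
    then obtain n where n: "norm (cesaro \<mu> n (left_translation s :: ('g, complex) ell2 bop)) < e / (norm a + 1)"
      using cesaro_left_translation_small[OF \<mu> s, of "e / (norm a + 1)"] e by auto
    have "norm a * norm (cesaro \<mu> n (left_translation s :: ('g, complex) ell2 bop))
        \<le> (norm a + 1) * (e / (norm a + 1))"
      using n by (intro mult_mono) auto
    also have "\<dots> = e" using pos by simp
    finally show ?thesis using bound[of n] by simp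
  qed
  then have "cmod (\<tau> (\<sigma> a * translation s)) \<le> 0" by (rule field_le_epsilon)
  then show ?thesis by simp
qed

lemma stationary_state_diagonal:
  assumes \<mu>: "cstar_simple_measure \<mu>" and \<tau>: "state_on B \<tau>" "stationary_on B inner_action \<mu> \<tau>"
    and x: "x \<in> B"
  shows "\<tau> x = \<tau> (diagonal x)"
proof -
  note B = subalgebra_crossed_product one_in_crossed_product
  have diagonal_mem: "diagonal y \<in> B" if "y \<in> B" for y
    using diagonal_in_range[OF that] embedding_in_crossed_product by auto
  show ?thesis using x
  proof (induction rule: crossed_product_induct)
    case (monomial a s)
    show ?case
      using stationary_state_monomial[OF \<mu> \<tau>] by (simp add: diagonal_monomial state_zero[OF B \<tau>(1)])
  next
    case (add y z)
    then show ?case by (simp add: diagonal_add state_add[OF B \<tau>(1)] diagonal_mem)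
  next
    case (limit X l)
    have "(\<lambda>n. \<tau> (X n)) \<longlonglongrightarrow> \<tau> l"
      using limit by (intro state_tendsto[OF B \<tau>(1)])
    moreover have "(\<lambda>n. \<tau> (diagonal (X n))) \<longlonglongrightarrow> \<tau> (diagonal l)"
      using limit by (intro state_tendsto[OF B \<tau>(1)] diagonal_mem diagonal_tendsto)
    ultimately show ?case using limit by (auto intro: LIMSEQ_unique)
  qed
qed

end

theorem theorem3p1:
  fixes \<mu> :: "'g::{group_add, countable} pmf"
    and \<alpha> :: "'g \<Rightarrow> 'a::cstar_algebra \<Rightarrow> 'a"
    and \<pi> :: "'a \<Rightarrow> 'h::chilbert_space bop"
    and \<tau> :: "('g, 'h) ell2 bop \<Rightarrow> complex"
  assumes "cstar_simple_group TYPE('g)"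
    and "cstar_simple_measure \<mu>"
    and "action \<alpha>"
    and "faithful_representation \<pi>"
    and "state_on (crossed_product \<alpha> \<pi>) \<tau>"
    and "stationary_on (crossed_product \<alpha> \<pi>) inner_action \<mu> \<tau>"
  shows "\<exists>\<nu>. state_on UNIV \<nu> \<and> stationary_on UNIV \<alpha> \<mu> \<nu> \<and>
    (\<forall>x\<in>crossed_product \<alpha> \<pi>.
       \<tau> x = (\<nu> \<circ> inv (crossed_embedding \<alpha> \<pi>) \<circ> canonical_expectation \<alpha> \<pi>) x)"
proof -
  interpret crossed_system \<alpha> \<pi> by unfold_locales fact+
  note \<tau> = assms(5,6)
  note B = subalgebra_crossed_product one_in_crossed_product
  define \<nu> where "\<nu> a = \<tau> (\<sigma> a)" for a
  have state: "state_on UNIV \<nu>"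
    unfolding state_on_def \<nu>_def
    by (simp add: star_hom_add[OF star_hom_embedding] star_hom_scaleC[OF star_hom_embedding]
        star_hom_mult[OF star_hom_embedding] star_hom_star[OF star_hom_embedding]
        star_hom_one[OF star_hom_embedding] state_add[OF B \<tau>(1)] state_scaleC[OF B \<tau>(1)]
        state_nonneg[OF B \<tau>(1)] state_one[OF B \<tau>(1)] embedding_in_crossed_product)
  \<comment> \<open>By covariance, \<open>\<sigma>\<close> turns \<open>\<alpha>\<close> into the
    inner action, so the two convolutions are the same sum.\<close>
  have "convolve \<alpha> \<mu> \<nu> a = convolve inner_action \<mu> \<tau> (\<sigma> a)" for a
    by (simp add: convolve_def translate_state_def \<nu>_def inner_action_embedding)
  then have stationary: "stationary_on UNIV \<alpha> \<mu> \<nu>"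
    using \<tau>(2) embedding_in_crossed_product by (simp add: stationary_on_def \<nu>_def)
  have "\<tau> x = (\<nu> \<circ> inv \<sigma> \<circ> canonical_expectation \<alpha> \<pi>) x" if x: "x \<in> B" for x
  proof -
    obtain a where a: "diagonal x = \<sigma> a" using diagonal_in_range[OF x] by blast
    then show ?thesis
      using stationary_state_diagonal[OF assms(2) \<tau> x]
      by (simp add: canonical_expectation_eq[OF x] inv_f_f[OF inj_embedding] \<nu>_def)
  qed
  with state stationary show ?thesis by blast
qed

end
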